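(* Let $k<n$ be positive integers and let $\Sigma_0\in\mathbb{R}^{n\times n}$ be positive definite. For the algorithm \begin{align*} R_t&=I-H_t^\top(H_tH_t^\top+D_t)^{-1}(H_tH_t^\top+D_t-\Sigma_0)(H_tH_t^\top+D_t)^{-1}H_t,\\ H_{t+1}&=\Sigma_0(H_tH_t^\top+D_t)^{-1}H_tR_t^{-1/2},\\ D_{t+1}&=\Delta(\Sigma_0-H_{t+1}H_{t+1}^\top), \end{align*} initialized as described in the context, the following hold for all $t$. (a) $D_t>0$ and $(D_t)_{ii}\le(\Sigma_0)_{ii}$. (b) $R_t$ is invertible. (c) If $H_0$ is of full column rank, so is $H_t$. (d) $H_tH_t^\top\le\Sigma_0$. (e) If $\Sigma_0=H_0H_0^\top+D_0$ then the algorithm stops. (f) The objective function decreases at each iteration. More precisely, let $\Sigma_{0,t}$ be the solution of the first partial minimization with data $\Sigma_t=\Sigma(H_t,D_t,Q_t)$, i.e. the minimizer of $\Sigma'\mapsto D(\Sigma'\|\Sigma_t)$ over $\Sigma'\in\boldsymbol{\Sigma}_0$. Then \[ D(\Sigma_0\|H_{t+1}H_{t+1}^\top+D_{t+1})-D(\Sigma_0\|H_tH_t^\top+D_t)=-\Big(D(\Sigma_{t+1}\|\Sigma_t)+D(\Sigma_{0,t}\|\Sigma_{0,t+1})\Big). \] (g) The limit points $(H,D)$ of the algorithm satisfy the relations \begin{align*} H&=(\Sigma_0-HH^\top)D^{-1}H,\\ D&=\Delta(\Sigma_0-HH^\top). \end{align*}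
   Context: For symmetric matrices, $M>0$ means positive definite, $A\le B$ means $B-A$ is positive semidefinite, and $|M|$ is the determinant. For positive definite $m\times m$ matrices $A,B$, the I-divergence is $D(A\|B)=\frac12\log\frac{|B|}{|A|}+\frac12\mathrm{tr}(B^{-1}A)-\frac m2$. For a positive definite matrix $P$, $P^{1/2}$ denotes any (square) matrix satisfying $(P^{1/2})^\top P^{1/2}=P$, and $P^{-1/2}$ denotes its inverse. For a square matrix $M$, $\Delta(M)$ is the diagonal matrix with $\Delta(M)_{ii}=M_{ii}$. Initialization of the algorithm: $H_0\in\mathbb{R}^{n\times k}$ is of full rank, $D_0>0$ is diagonal of size $n$, $Q_0\in\mathbb{R}^{k\times k}$ is invertible, and $H_0H_0^\top+D_0$ is invertible. The iterates $R_t,H_{t+1},D_{t+1}$ are then computed by the displayed recursions. The auxiliary matrices $Q_t\in\mathbb{R}^{k\times k}$, which do not enter the recursions for $H_t,D_t$, are given by $Q_{t+1}=R_t^{1/2}Q_t$ (with the same square root $R_t^{1/2}$ as in the update of $H_{t+1}$). Notation for (f): $\boldsymbol{\Sigma}_0$ is the set of positive definite matrices in $\mathbb{R}^{(n+k)\times(n+k)}$ whose upper left $n\times n$ block equals $\Sigma_0$, and \[ \Sigma(H,D,Q)=\begin{pmatrix}HH^\top+D&HQ\\(HQ)^\top&Q^\top Q\end{pmatrix}. \] The objective function is $(H,D)\mapsto D(\Sigma_0\|HH^\top+D)$, to be minimized over $H\in\mathbb{R}^{n\times k}$ and diagonal $D>0$ of size $n$.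
   Formalization: The bound on (D_t)_ii in (a) and (d) are stated for t ≥ 1, as they can fail for the initial data; in (e) H_t stops up to an orthogonal factor, exactly if the chosen root of I is I; in (g) the relation containing D^{-1} is stated for limit points with invertible D. *)

theory Defs
  imports "HOL-Analysis.Analysis"
begin

definition pos_semidef :: "real^'m^'m \<Rightarrow> bool" where
  "pos_semidef M \<longleftrightarrow> transpose M = M \<and> (\<forall>x. x \<bullet> (M *v x) \<ge> 0)"

definition pos_def :: "real^'m^'m \<Rightarrow> bool" where
  "pos_def M \<longleftrightarrow> transpose M = M \<and> (\<forall>x. x \<noteq> 0 \<longrightarrow> x \<bullet> (M *v x) > 0)"

definition psd_le :: "real^'m^'m \<Rightarrow> real^'m^'m \<Rightarrow> bool" where
  "psd_le A B \<longleftrightarrow> pos_semidef (B - A)"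

definition is_diagonal :: "real^'m^'m \<Rightarrow> bool" where
  "is_diagonal M \<longleftrightarrow> (\<forall>i j. i \<noteq> j \<longrightarrow> M $ i $ j = 0)"

definition diag_part :: "real^'m^'m \<Rightarrow> real^'m^'m" where
  "diag_part M = (\<chi> i j. if i = j then M $ i $ i else 0)"

(* Meaningful for positive definite arguments only. *)
definition I_div :: "real^'m^'m \<Rightarrow> real^'m^'m \<Rightarrow> real" where
  "I_div A B = 1/2 * ln (det B / det A) + 1/2 * trace (matrix_inv B ** A) - real CARD('m) / 2"

(* A square root P^(1/2) of P is any square matrix with (P^(1/2))^T P^(1/2) = P;
   it is neither unique nor required to be symmetric. *)
definition is_matrix_sqrt :: "real^'m^'m \<Rightarrow> real^'m^'m \<Rightarrow> bool" where
  "is_matrix_sqrt W P \<longleftrightarrow> transpose W ** W = P"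

(* (n+k) x (n+k) matrices are indexed by the sum type: Inl for the first n, Inr for the last k
   coordinates. *)
definition block_matrix ::
    "real^'n^'n \<Rightarrow> real^'k^'n \<Rightarrow> real^'n^'k \<Rightarrow> real^'k^'k \<Rightarrow> real^('n + 'k)^('n + 'k)" where
  "block_matrix A B C E = (\<chi> i j.
     case i of
       Inl a \<Rightarrow> (case j of Inl b \<Rightarrow> A $ a $ b | Inr b \<Rightarrow> B $ a $ b)
     | Inr a \<Rightarrow> (case j of Inl b \<Rightarrow> C $ a $ b | Inr b \<Rightarrow> E $ a $ b))"

definition upper_left :: "real^('n::finite + 'k::finite)^('n + 'k) \<Rightarrow> real^'n^'n" where
  "upper_left M = (\<chi> i j. M $ Inl i $ Inl j)"

definition Sigma0_set :: "real^'n^'n \<Rightarrow> (real^('n::finite + 'k::finite)^('n + 'k)) set" where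
  "Sigma0_set S0 = {M. pos_def M \<and> upper_left M = S0}"

definition fa_cov :: "real^'k^'n \<Rightarrow> real^'n^'n \<Rightarrow> real^'n^'n" where
  "fa_cov H D = H ** transpose H + D"

definition Sigma_HDQ :: "real^'k^'n \<Rightarrow> real^'n^'n \<Rightarrow> real^'k^'k \<Rightarrow> real^('n + 'k)^('n + 'k)" where
  "Sigma_HDQ H D Q =
     block_matrix (fa_cov H D) (H ** Q) (transpose (H ** Q)) (transpose Q ** Q)"

definition R_update :: "real^'n^'n \<Rightarrow> real^'k^'n \<Rightarrow> real^'n^'n \<Rightarrow> real^'k^'k" where
  "R_update S0 H D =
     mat 1 - transpose H ** matrix_inv (fa_cov H D) ** (fa_cov H D - S0)
               ** matrix_inv (fa_cov H D) ** H"

definition is_first_partial_min ::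
    "real^'n^'n \<Rightarrow> real^('n::finite + 'k::finite)^('n + 'k) \<Rightarrow> real^('n + 'k)^('n + 'k) \<Rightarrow> bool" where
  "is_first_partial_min S0 S1 M \<longleftrightarrow>
     is_arg_min (\<lambda>M'. I_div M' S1) (\<lambda>M'. M' \<in> Sigma0_set S0) M"

(* A run of the algorithm.  W t is the chosen square root R_t^(1/2).  Square roots exist for
   positive definite matrices only, so W t is constrained only when R_t is positive definite;
   that this is always the case is not assumed. *)
definition fa_algorithm ::
    "real^'n^'n \<Rightarrow> (nat \<Rightarrow> real^'k^'n) \<Rightarrow> (nat \<Rightarrow> real^'n^'n) \<Rightarrow> (nat \<Rightarrow> real^'k^'k) \<Rightarrow>
     (nat \<Rightarrow> real^'k^'k) \<Rightarrow> (nat \<Rightarrow> real^'k^'k) \<Rightarrow> bool" where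
  "fa_algorithm S0 H D Q R W \<longleftrightarrow>
     rank (H 0) = min CARD('n) CARD('k) \<and>
     pos_def (D 0) \<and> is_diagonal (D 0) \<and>
     invertible (Q 0) \<and>
     invertible (fa_cov (H 0) (D 0)) \<and>
     (\<forall>t. R t = R_update S0 (H t) (D t)) \<and>
     (\<forall>t. pos_def (R t) \<longrightarrow> is_matrix_sqrt (W t) (R t)) \<and>
     (\<forall>t. H (Suc t) = S0 ** matrix_inv (fa_cov (H t) (D t)) ** H t ** matrix_inv (W t)) \<and>
     (\<forall>t. D (Suc t) = diag_part (S0 - H (Suc t) ** transpose (H (Suc t)))) \<and>
     (\<forall>t. Q (Suc t) = W t ** Q t)"

definition is_limit_point :: "(nat \<Rightarrow> 'a::topological_space) \<Rightarrow> 'a \<Rightarrow> bool" where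
  "is_limit_point X l \<longleftrightarrow> (\<exists>r::nat \<Rightarrow> nat. strict_mono r \<and> (X \<circ> r) \<longlonglongrightarrow> l)"

end

theory Submission
  imports Defs
begin

text \<open>
  The algorithm is an alternating minimization of the I-divergence between two families of joint
  covariances of \<open>n\<close> observations and \<open>k\<close> hidden factors: those with prescribed observation covariance
  \<open>S0\<close>, and those of the form \<open>Sigma_HDQ H D Q\<close>.

  Both partial minimizations obey a Pythagorean identity. In the first one, the conditional law of
  the factors given the observations is kept and the marginal \<open>fa_cov H D\<close> is replaced by \<open>S0\<close>; the
  divergence to \<open>Sigma_HDQ H D Q\<close> exceeds the divergence to the minimizer by the objective value
  \<open>I_div S0 (fa_cov H D)\<close> (\<open>I_div_regression_block\<close>). In the second one, the new joint covariance agrees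
  with that minimizer except in the observation block, where the error has zero diagonal. The
  observation block of the inverse of \<open>Sigma_HDQ H D Q\<close> is the inverse of \<open>D\<close>, hence diagonal, so the error
  is orthogonal to it (\<open>second_pythagoras\<close>). Adding these identities gives the decrease in (f), exactly
  (\<open>I_div_step\<close>).

  Positivity comes from the same picture. The minimizer of the first step is a positive definite
  block matrix; up to a congruence by \<open>Q\<close>, its factor block is \<open>R\<close>, which gives (b), and its conditional
  covariance of the observations given the factors is \<open>S0 - H' ** transpose H'\<close> for the new \<open>H'\<close>, which
  gives (a) and (d). The rank is preserved since \<open>H\<close> is only multiplied by invertible matrices. In (e) the
  model covariance already equals \<open>S0\<close>, which forces \<open>R = mat 1\<close> and leaves only an orthogonal factor.

  For (g), one iteration acts continuously on \<open>fa_cov H D\<close>, and the objective values converge. At a limit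
  point with invertible \<open>D\<close> one iteration therefore does not lower the objective, hence by (f) and the
  definiteness of the I-divergence (\<open>I_div_eq_0_imp_eq\<close>) it does not move the joint covariance
  (\<open>stationary_equation\<close>). Definiteness is obtained by diagonalizing two quadratic forms
  simultaneously (\<open>simultaneous_diagonalization\<close>), which reduces it to \<open>ln x \<le> x - 1\<close>.
\<close>

section \<open>Simultaneous diagonalization of two quadratic forms\<close>

lemma symmetric_bilinear:
  fixes A :: "real^'m^'m"
  assumes "transpose A = A"
  shows "x \<bullet> (A *v y) = y \<bullet> (A *v x)"
  using assms by (metis dot_lmul_matrix inner_commute transpose_matrix_vector)

text \<open>
  First-order condition at a maximum: a term linear in the variation \<open>s\<close> cannot be dominated by a
  quadratic one for both signs of \<open>s\<close>.
\<close>

lemma quadratic_bound_imp_zero: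
  fixes c e :: real
  assumes "\<And>s. 2 * s * c \<le> s\<^sup>2 * e"
  shows "c = 0"
proof -
  define E where "E = \<bar>e\<bar> + 1"
  have E: "E > 0" "e \<le> E" by (auto simp: E_def)
  have "2 * (c/E) * c \<le> (c/E)\<^sup>2 * e" by (rule assms)
  also have "\<dots> \<le> (c/E)\<^sup>2 * E" using E by (intro mult_left_mono) auto
  finally have "c * c \<le> 0" using E by (simp add: field_simps power2_eq_square)
  then show ?thesis by (metis mult_eq_0_iff not_square_less_zero order_antisym_conv not_less)
qed

text \<open>
  On a subspace \<open>V\<close>, a maximizer \<open>u\<close> of the quotient of the two quadratic forms \<open>A\<close> and \<open>B\<close> is an
  eigenvector of the pair in the weak sense: within \<open>V\<close>, being \<open>B\<close>-orthogonal to \<open>u\<close> implies being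
  \<open>A\<close>-orthogonal to \<open>u\<close>. The maximum exists because the unit sphere of \<open>V\<close> is compact.
\<close>

lemma rayleigh_maximizer:
  fixes A B :: "real^'m^'m"
  assumes B: "pos_def B" and A: "transpose A = A"
    and V: "subspace V" and ne: "x0 \<in> V" "x0 \<noteq> 0"
  obtains u where "u \<in> V" "u \<bullet> (B *v u) = 1"
    "\<And>w. w \<in> V \<Longrightarrow> u \<bullet> (B *v w) = 0 \<Longrightarrow> u \<bullet> (A *v w) = 0"
proof -
  define g where "g x = (x \<bullet> (A *v x)) / (x \<bullet> (B *v x))" for x :: "real^'m"
  define K where "K = sphere 0 1 \<inter> V"
  have Bpos: "x \<bullet> (B *v x) > 0" if "x \<noteq> 0" for x using B that by (auto simp: pos_def_def)
  have Bsym: "transpose B = B" using B by (auto simp: pos_def_def)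
  have cK: "compact K" unfolding K_def
    by (intro compact_Int_closed closed_subspace V) simp
  have "(1 / norm x0) *\<^sub>R x0 \<in> K" using ne V by (auto simp: K_def subspace_scale)
  then have "K \<noteq> {}" by auto
  moreover have "continuous_on K g" unfolding g_def
  proof (intro continuous_intros linear_continuous_on matrix_vector_mul_bounded_linear ballI)
    fix x assume "x \<in> K"
    then have "x \<noteq> 0" by (auto simp: K_def)
    then show "x \<bullet> (B *v x) \<noteq> 0" using Bpos by force
  qed
  ultimately obtain u0 where u0: "u0 \<in> K" "\<And>x. x \<in> K \<Longrightarrow> g x \<le> g u0"
    using continuous_attains_sup[OF cK] by metis
  define c where "c = g u0"
  have bound: "x \<bullet> (A *v x) \<le> c * (x \<bullet> (B *v x))" if "x \<in> V" for x
  proof (cases "x = 0")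
    case False
    define y where "y = (1 / norm x) *\<^sub>R x"
    have "y \<in> K" using False that V by (auto simp: K_def y_def subspace_scale)
    then have "g y \<le> c" using u0 by (simp add: c_def)
    moreover have "g y = g x" using False by (simp add: g_def y_def matrix_vector_mult_scaleR)
    ultimately have "g x \<le> c" by simp
    then show ?thesis using Bpos[OF False] by (simp add: g_def field_simps)
  qed auto
  have u00: "u0 \<noteq> 0" "u0 \<in> V" using u0(1) by (auto simp: K_def)
  define u where "u = (1 / sqrt (u0 \<bullet> (B *v u0))) *\<^sub>R u0"
  have uV: "u \<in> V" using u00 V by (simp add: u_def subspace_scale)
  have uB: "u \<bullet> (B *v u) = 1" using Bpos[OF u00(1)]
    by (simp add: u_def matrix_vector_mult_scaleR field_simps)
  have uA: "u \<bullet> (A *v u) = c" using Bpos[OF u00(1)]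
    by (simp add: u_def matrix_vector_mult_scaleR c_def g_def field_simps)
  show ?thesis
  proof (rule that[OF uV uB])
    fix w assume w: "w \<in> V" "u \<bullet> (B *v w) = 0"
    have wB: "w \<bullet> (B *v u) = 0" using w(2) symmetric_bilinear[OF Bsym, of w u] by simp
    have wA: "w \<bullet> (A *v u) = u \<bullet> (A *v w)" using symmetric_bilinear[OF A] .
    show "u \<bullet> (A *v w) = 0"
    proof (rule quadratic_bound_imp_zero)
      fix s :: real
      have "u + s *\<^sub>R w \<in> V" using uV w V by (simp add: subspace_add subspace_scale)
      from bound[OF this] 
      show "2 * s * (u \<bullet> (A *v w)) \<le> s\<^sup>2 * (c * (w \<bullet> (B *v w)) - w \<bullet> (A *v w))"
        using w(2) wB wA uA uB
        by (simp add: matrix_vector_right_distrib matrix_vector_mult_scaleR inner_add_left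
            inner_add_right algebra_simps power2_eq_square)
    qed
  qed
qed

text \<open>
  Rayleigh maximizers are chosen greedily, one for each index of \<open>I\<close>, each in the \<open>B\<close>-orthogonal
  complement of the earlier ones. The last clause is what the induction needs: it says that this
  complement is also \<open>A\<close>-orthogonal to the chosen vectors, so that the next one is orthogonal to them
  for both forms.
\<close>

lemma partial_simultaneous_eigenbasis:
  fixes A B :: "real^'m^'m" and I :: "'m set"
  assumes B: "pos_def B" and A: "transpose A = A"
  shows "\<exists>v. (\<forall>i\<in>I. \<forall>j\<in>I. v i \<bullet> (B *v v j) = (if i = j then 1 else 0)) \<and>
             (\<forall>i\<in>I. \<forall>j\<in>I. i \<noteq> j \<longrightarrow> v i \<bullet> (A *v v j) = 0) \<and>
             (\<forall>w. (\<forall>i\<in>I. v i \<bullet> (B *v w) = 0) \<longrightarrow> (\<forall>i\<in>I. v i \<bullet> (A *v w) = 0))"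
proof (induction I rule: finite_induct[OF finite])
  case 1
  then show ?case by simp
next
  case (2 a I)
  have Bsym: "transpose B = B" using B by (auto simp: pos_def_def)
  obtain v where
      "\<forall>i\<in>I. \<forall>j\<in>I. v i \<bullet> (B *v v j) = (if i = j then 1 else 0)"
      "\<forall>i\<in>I. \<forall>j\<in>I. i \<noteq> j \<longrightarrow> v i \<bullet> (A *v v j) = 0"
      "\<forall>w. (\<forall>i\<in>I. v i \<bullet> (B *v w) = 0) \<longrightarrow> (\<forall>i\<in>I. v i \<bullet> (A *v w) = 0)"
    using 2(3) by (elim exE conjE)
  then have v: "\<And>i j. i \<in> I \<Longrightarrow> j \<in> I \<Longrightarrow> v i \<bullet> (B *v v j) = (if i = j then 1 else 0)"
    "\<And>i j. i \<in> I \<Longrightarrow> j \<in> I \<Longrightarrow> i \<noteq> j \<Longrightarrow> v i \<bullet> (A *v v j) = 0"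
    "\<And>w i. (\<And>i. i \<in> I \<Longrightarrow> v i \<bullet> (B *v w) = 0) \<Longrightarrow> i \<in> I \<Longrightarrow> v i \<bullet> (A *v w) = 0"
    by auto
  define V where "V = {x. \<forall>i\<in>I. v i \<bullet> (B *v x) = 0}"
  have V: "subspace V"
    by (auto simp: V_def subspace_def matrix_vector_right_distrib matrix_vector_mult_scaleR inner_add_right)
  \<comment> \<open>Fewer than \<open>CARD('m)\<close> linear constraints define \<open>V\<close>, hence \<open>V\<close> contains a nonzero vector.\<close>
  have "dim ((\<lambda>i. B *v v i) ` I) \<le> card ((\<lambda>i. B *v v i) ` I)" by (rule dim_le_card') simp
  also have "\<dots> \<le> card I" by (rule card_image_le) simp
  also have "\<dots> < CARD('m)" by (rule psubset_card_mono) (use 2(2) in auto)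
  finally have "dim ((\<lambda>i. B *v v i) ` I) < DIM(real^'m)" by simp
  then obtain x0 where x0: "x0 \<noteq> 0" "\<And>y. y \<in> span ((\<lambda>i. B *v v i) ` I) \<Longrightarrow> orthogonal x0 y"
    using orthogonal_to_subspace_exists by blast
  have "x0 \<in> V" unfolding V_def
  proof (intro CollectI ballI)
    fix i assume "i \<in> I"
    then have "x0 \<bullet> (B *v v i) = 0" using x0(2) by (auto simp: orthogonal_def intro: span_base)
    then show "v i \<bullet> (B *v x0) = 0" using symmetric_bilinear[OF Bsym, of x0 "v i"] by simp
  qed
  then obtain u where u: "u \<in> V" "u \<bullet> (B *v u) = 1"
    "\<And>w. w \<in> V \<Longrightarrow> u \<bullet> (B *v w) = 0 \<Longrightarrow> u \<bullet> (A *v w) = 0"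
    using rayleigh_maximizer[OF B A V _ x0(1)] by blast
  have uB: "v i \<bullet> (B *v u) = 0" "u \<bullet> (B *v v i) = 0" if "i \<in> I" for i
    using u(1) that symmetric_bilinear[OF Bsym, of u "v i"] by (auto simp: V_def)
  have uA: "v i \<bullet> (A *v u) = 0" "u \<bullet> (A *v v i) = 0" if "i \<in> I" for i
    using v(3)[OF uB(1) that] symmetric_bilinear[OF A, of u "v i"] by auto
  show ?case
  proof (intro exI[of _ "v(a := u)"] conjI ballI impI allI)
    fix i j assume "i \<in> insert a I" "j \<in> insert a I"
    then show "(v(a := u)) i \<bullet> (B *v (v(a := u)) j) = (if i = j then 1 else 0)"
      using v(1) uB u(2) 2 by auto
  next
    fix i j assume "i \<in> insert a I" "j \<in> insert a I" "i \<noteq> j"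
    then show "(v(a := u)) i \<bullet> (A *v (v(a := u)) j) = 0"
      using v(2) uA 2 by auto
  next
    fix w i assume w: "\<forall>i\<in>insert a I. (v(a := u)) i \<bullet> (B *v w) = 0" and i: "i \<in> insert a I"
    have wI: "v i \<bullet> (B *v w) = 0" if "i \<in> I" for i
    proof -
      have "i \<noteq> a" using that 2(2) by auto
      then show ?thesis using bspec[OF w insertI2[OF that]] by simp
    qed
    then have "w \<in> V" by (auto simp: V_def)
    moreover have "u \<bullet> (B *v w) = 0" using w by auto
    ultimately show "(v(a := u)) i \<bullet> (A *v w) = 0" using i u(3) v(3)[OF wI] by auto
  qed
qed

lemma congruence_component:
  fixes A P :: "real^'m^'m"
  shows "(transpose P ** A ** P) $ i $ j = column i P \<bullet> (A *v column j P)"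
proof -
  have "(transpose P ** (A ** P)) $ i $ j = column i P \<bullet> (A *v column j P)"
    by (simp add: matrix_matrix_mult_def matrix_vector_mult_def transpose_def column_def inner_vec_def)
  then show ?thesis by (simp add: matrix_mul_assoc)
qed

text \<open>
  The columns of \<open>P\<close> form a basis that is orthonormal for \<open>B\<close> and orthogonal for \<open>A\<close>. This single
  fact replaces the spectral theorem, determinant inequalities and matrix square roots below.
\<close>

lemma simultaneous_diagonalization:
  fixes A B :: "real^'m^'m"
  assumes B: "pos_def B" and A: "transpose A = A"
  obtains P :: "real^'m^'m" and d where "invertible P" "transpose P ** B ** P = mat 1"
    "transpose P ** A ** P = (\<chi> i j. if i = j then d i else 0)"
proof -
  obtain v where v: "\<And>i j::'m. v i \<bullet> (B *v v j) = (if i = j then 1 else 0)"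
    "\<And>i j::'m. i \<noteq> j \<Longrightarrow> v i \<bullet> (A *v v j) = 0"
    using partial_simultaneous_eigenbasis[OF B A, of UNIV] by auto
  define P :: "real^'m^'m" where "P = (\<chi> i j. v j $ i)"
  have col: "column j P = v j" for j by (simp add: P_def column_def vec_eq_iff)
  have 1: "transpose P ** B ** P = mat 1"
    by (simp add: vec_eq_iff congruence_component col v mat_def)
  have 2: "transpose P ** A ** P = (\<chi> i j. if i = j then v i \<bullet> (A *v v i) else 0)"
    by (simp add: vec_eq_iff congruence_component col v)
  have "invertible P" using 1 unfolding invertible_left_inverse by blast
  from that[OF this 1 2] show ?thesis .
qed

section \<open>Positive definite matrices and congruence\<close>

lemma matrix_inv_mult [simp]:
  fixes A :: "real^'m^'m"
  assumes "invertible A"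
  shows "A ** matrix_inv A = mat 1" "matrix_inv A ** A = mat 1"
proof -
  have "\<exists>A'. A ** A' = mat 1 \<and> A' ** A = mat 1" using assms by (simp add: invertible_def)
  then have "A ** matrix_inv A = mat 1 \<and> matrix_inv A ** A = mat 1"
    unfolding matrix_inv_def by (rule someI_ex)
  then show "A ** matrix_inv A = mat 1" "matrix_inv A ** A = mat 1" by auto
qed

lemma matrix_inv_cancel [simp]:
  fixes A :: "real^'m^'m" and X :: "real^'m^'a"
  assumes "invertible A"
  shows "X ** A ** matrix_inv A = X" "X ** matrix_inv A ** A = X"
  using assms by (simp_all flip: matrix_mul_assoc)

lemma matrix_inv_eqI:
  fixes A B :: "real^'m^'m"
  assumes "A ** B = mat 1"
  shows "matrix_inv A = B"
proof -
  have "invertible A" using assms invertible_right_inverse by blast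
  then have "matrix_inv A ** A ** B = B" by simp
  then show ?thesis using assms by (simp flip: matrix_mul_assoc)
qed

lemma matrix_inv_mat_1 [simp]: "matrix_inv (mat 1 :: real^'m^'m) = mat 1"
  by (rule matrix_inv_eqI) simp

lemma invertible_matrix_inv [simp]:
  fixes A :: "real^'m^'m"
  assumes "invertible A"
  shows "invertible (matrix_inv A)"
  unfolding invertible_def[of "matrix_inv A"] using assms by (intro exI[of _ A]) simp

lemma transpose_matrix_inv:
  fixes A :: "real^'m^'m"
  assumes "invertible A"
  shows "transpose (matrix_inv A) = matrix_inv (transpose A)"
  using assms matrix_inv_eqI[of "transpose A" "transpose (matrix_inv A)"]
  by (simp flip: matrix_transpose_mul)

lemma matrix_inv_matrix_mult:
  fixes A B :: "real^'m^'m"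
  assumes "invertible A" "invertible B"
  shows "matrix_inv (A ** B) = matrix_inv B ** matrix_inv A"
  by (rule matrix_inv_eqI) (use assms in \<open>simp add: matrix_mul_assoc\<close>)

lemma congruence_eq_iff:
  fixes A B P :: "real^'m^'m"
  assumes "invertible P"
  shows "transpose P ** A ** P = transpose P ** B ** P \<longleftrightarrow> A = B"
proof
  assume *: "transpose P ** A ** P = transpose P ** B ** P"
  have T: "invertible (transpose P)" using assms by (simp add: transpose_invertible)
  have "matrix_inv (transpose P) ** (transpose P ** A ** P) ** matrix_inv P
      = matrix_inv (transpose P) ** (transpose P ** B ** P) ** matrix_inv P" using * by simp
  then show "A = B" using assms T by (simp add: matrix_mul_assoc)
qed simp

lemma pos_def_congruence:
  fixes A P :: "real^'m^'m"
  assumes P: "invertible P"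
  shows "pos_def (transpose P ** A ** P) \<longleftrightarrow> pos_def A"
proof -
  have sym: "transpose (transpose P ** A ** P) = transpose P ** A ** P \<longleftrightarrow> transpose A = A"
    using congruence_eq_iff[OF P] by (simp add: matrix_transpose_mul matrix_mul_assoc)
  have q: "x \<bullet> ((transpose P ** A ** P) *v x) = (P *v x) \<bullet> (A *v (P *v x))" for x
    using dot_lmul_matrix[of x "transpose P" "A *v (P *v x)"]
    by (simp add: matrix_vector_mul_assoc matrix_mul_assoc del: transpose_matrix_vector)
  have s: "P *v (matrix_inv P *v x) = x" "matrix_inv P *v (P *v x) = x" for x
    using P by (simp_all add: matrix_vector_mul_assoc)
  have 0: "P *v x = 0 \<longleftrightarrow> x = 0" for x
    using s(2)[of x] by auto
  have "(\<forall>x. x \<noteq> 0 \<longrightarrow> (P *v x) \<bullet> (A *v (P *v x)) > 0) \<longleftrightarrow> (\<forall>y. y \<noteq> 0 \<longrightarrow> y \<bullet> (A *v y) > 0)"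
    (is "?l \<longleftrightarrow> ?r")
  proof
    assume ?l
    show ?r
    proof (intro allI impI)
      fix y :: "real^'m" assume "y \<noteq> 0"
      then have "matrix_inv P *v y \<noteq> 0" using s[of y] by auto
      with \<open>?l\<close> have "(P *v (matrix_inv P *v y)) \<bullet> (A *v (P *v (matrix_inv P *v y))) > 0" by blast
      then show "y \<bullet> (A *v y) > 0" unfolding s .
    qed
  qed (use 0 in auto)
  then show ?thesis unfolding pos_def_def sym q by simp
qed

lemma pos_def_symmetric: "pos_def A \<Longrightarrow> transpose A = A"
  by (simp add: pos_def_def)

lemma pos_def_diagonal_pos:
  assumes "pos_def D"
  shows "D $ i $ i > 0"
proof -
  have "axis i 1 \<bullet> (D *v axis i 1) > 0" using assms by (simp add: pos_def_def axis_eq_0_iff)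
  then show ?thesis by (simp add: matrix_vector_mult_basis column_def inner_axis')
qed

lemma pos_def_det_pos:
  fixes A :: "real^'m^'m"
  assumes "pos_def A"
  shows "det A > 0"
proof -
  obtain P :: "real^'m^'m" and d where P: "invertible P" "transpose P ** A ** P = mat 1"
    "transpose P ** A ** P = (\<chi> i j. if i = j then d i else 0)"
    by (rule simultaneous_diagonalization[OF assms pos_def_symmetric[OF assms]])
  from arg_cong[OF P(2), of det] have "(det P)\<^sup>2 * det A = 1"
    by (simp add: det_mul power2_eq_square mult_ac)
  then have "0 < (det P)\<^sup>2 * det A" by simp
  then show ?thesis by (simp add: zero_less_mult_iff)
qed

lemma pos_def_invertible [simp]: "pos_def A \<Longrightarrow> invertible A"
  using pos_def_det_pos[of A] by (auto simp: invertible_det_nz)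

lemma pos_def_mat_1: "pos_def (mat 1 :: real^'m^'m)"
  by (simp add: pos_def_def)

text \<open>
  If the columns of \<open>P\<close> are orthonormal for \<open>A\<close>, then the inverse of \<open>P\<close> is a square root of \<open>A\<close>.
\<close>

lemma pos_def_square_root_exists:
  fixes A :: "real^'m^'m"
  assumes "pos_def A"
  obtains W :: "real^'m^'m" where "transpose W ** W = A"
proof -
  obtain P :: "real^'m^'m" and d where P: "invertible P" "transpose P ** A ** P = mat 1"
    "transpose P ** A ** P = (\<chi> i j. if i = j then d i else 0)"
    by (rule simultaneous_diagonalization[OF assms pos_def_symmetric[OF assms]])
  have "transpose P ** transpose (matrix_inv P) = mat 1"
    using P by (simp flip: matrix_transpose_mul)
  then have "transpose P ** (transpose (matrix_inv P) ** mat 1 ** matrix_inv P) ** P = transpose P ** A ** P"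
    using P by (simp add: matrix_mul_assoc)
  then have "transpose (matrix_inv P) ** matrix_inv P = A"
    using congruence_eq_iff[OF P(1)] by simp
  then show ?thesis using that by blast
qed

section \<open>The I-divergence of positive definite matrices\<close>

text \<open>
  Determinant ratio and trace of \<open>matrix_inv B ** A\<close> are invariant under a common congruence of \<open>A\<close> and \<open>B\<close>.
  In the basis that makes \<open>B\<close> the identity and \<open>A\<close> diagonal, the divergence becomes a sum of
  one-dimensional divergences of variances \<open>d i\<close> from variance 1.
\<close>

lemma I_div_simultaneous_diagonal:
  fixes A B :: "real^'m^'m"
  assumes A: "pos_def A" and B: "pos_def B"
  obtains d :: "'m \<Rightarrow> real" where "\<And>i. d i > 0" "I_div A B = (\<Sum>i\<in>UNIV. (d i - 1 - ln (d i)) / 2)"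
    "(\<forall>i. d i = 1) \<longleftrightarrow> A = B"
proof -
  obtain P :: "real^'m^'m" and d where P: "invertible P" "transpose P ** B ** P = mat 1"
    "transpose P ** A ** P = (\<chi> i j. if i = j then d i else 0)" (is "_ = ?D")
    by (rule simultaneous_diagonalization[OF B pos_def_symmetric[OF A]])
  have D: "pos_def ?D" using A pos_def_congruence[OF P(1), of A] unfolding P(3) by simp
  have d: "d i > 0" for i
    using pos_def_diagonal_pos[OF D, of i] by simp
  have dB: "(det P)\<^sup>2 * det B = 1" using arg_cong[OF P(2), of det]
    by (simp add: det_mul power2_eq_square mult_ac)
  have "det ?D = (\<Prod>i\<in>UNIV. d i)" by (subst det_diagonal) auto
  then have dA: "(det P)\<^sup>2 * det A = (\<Prod>i\<in>UNIV. d i)" using arg_cong[OF P(3), of det]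
    by (simp add: det_mul power2_eq_square mult_ac)
  have "det P \<noteq> 0" using dB by auto
  then have "det B / det A = ((det P)\<^sup>2 * det B) / ((det P)\<^sup>2 * det A)" by simp
  then have "det B / det A = 1 / (\<Prod>i\<in>UNIV. d i)" unfolding dA dB .
  then have ln: "ln (det B / det A) = - (\<Sum>i\<in>UNIV. ln (d i))"
    using d by (simp add: ln_div ln_prod prod_pos less_imp_neq[THEN not_sym])
  have inv: "matrix_inv B = P ** transpose P"
  proof (rule matrix_inv_eqI)
    have "transpose P ** (B ** (P ** transpose P)) = transpose P"
      using P(2) by (simp add: matrix_mul_assoc)
    then have "matrix_inv (transpose P) ** transpose P ** (B ** (P ** transpose P)) = matrix_inv (transpose P) ** transpose P"
      by (simp flip: matrix_mul_assoc)
    then show "B ** (P ** transpose P) = mat 1" using P(1) by (simp add: transpose_invertible)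
  qed
  have "trace (matrix_inv B ** A) = trace (transpose P ** A ** P)"
    unfolding inv using trace_mul_sym[of P "transpose P ** A"] by (simp add: matrix_mul_assoc)
  also have "\<dots> = (\<Sum>i\<in>UNIV. d i)" by (simp add: P(3) trace_def)
  finally have "I_div A B = (\<Sum>i\<in>UNIV. (d i - 1 - ln (d i)) / 2)"
    unfolding I_div_def ln by (simp add: sum_subtractf diff_divide_distrib flip: sum_divide_distrib)
  moreover have "(\<forall>i. d i = 1) \<longleftrightarrow> ?D = mat 1" by (auto simp: vec_eq_iff mat_def)
  then have "(\<forall>i. d i = 1) \<longleftrightarrow> A = B" using congruence_eq_iff[OF P(1), of A B] unfolding P(2,3) by simp
  ultimately show ?thesis using that d by blast
qed

lemma I_div_nonneg:
  fixes A B :: "real^'m^'m"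
  assumes "pos_def A" "pos_def B"
  shows "I_div A B \<ge> 0"
proof -
  obtain d :: "'m \<Rightarrow> real" where d: "\<And>i. d i > 0" "I_div A B = (\<Sum>i\<in>UNIV. (d i - 1 - ln (d i)) / 2)"
    using I_div_simultaneous_diagonal[OF assms] by metis
  show ?thesis unfolding d(2) using d(1) ln_le_minus_one by (intro sum_nonneg) (auto simp: algebra_simps)
qed

lemma I_div_eq_0_imp_eq:
  fixes A B :: "real^'m^'m"
  assumes "pos_def A" "pos_def B" "I_div A B = 0"
  shows "A = B"
proof -
  obtain d :: "'m \<Rightarrow> real" where d: "\<And>i. d i > 0" "I_div A B = (\<Sum>i\<in>UNIV. (d i - 1 - ln (d i)) / 2)"
    "(\<forall>i. d i = 1) \<longleftrightarrow> A = B"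
    using I_div_simultaneous_diagonal[OF assms(1,2)] by metis
  have "(d i - 1 - ln (d i)) / 2 \<ge> 0" for i
    using ln_le_minus_one[OF d(1)[of i]] by simp
  then have "\<forall>i\<in>UNIV. (d i - 1 - ln (d i)) / 2 = 0"
    using assms(3) unfolding d(2) by (subst (asm) sum_nonneg_eq_0_iff) auto
  then have "d i = 1" for i using ln_eq_minus_one[OF d(1)[of i]] by simp
  then show ?thesis using d(3) by blast
qed

section \<open>Block matrices\<close>

lemma matrix_mult_minus:
  fixes A :: "real^'b^'a" and B :: "real^'c^'b"
  shows "(- A) ** B = - (A ** B)" "A ** (- B) = - (A ** B)"
  by (simp_all add: vec_eq_iff matrix_matrix_mult_def sum_negf)

lemma matrix_add_rdistrib:
  fixes A B :: "real^'b^'a" and C :: "real^'c^'b"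
  shows "(A + B) ** C = A ** C + B ** C"
  by (simp add: vec_eq_iff matrix_matrix_mult_def sum.distrib algebra_simps)

lemma matrix_diff_distrib:
  fixes A B :: "real^'b^'a" and C D :: "real^'c^'b"
  shows "(A - B) ** C = A ** C - B ** C" "A ** (C - D) = A ** C - A ** D"
  by (simp_all add: vec_eq_iff matrix_matrix_mult_def sum_subtractf algebra_simps)

lemma transpose_linear:
  fixes A B :: "real^'b^'a"
  shows "transpose (A + B) = transpose A + transpose B"
    "transpose (A - B) = transpose A - transpose B"
    "transpose (- A) = - transpose A" "transpose (0 :: real^'b^'a) = 0"
  by (simp_all add: vec_eq_iff transpose_def)

lemmas matrix_algebra = matrix_mult_minus matrix_add_rdistrib matrix_add_ldistrib
  matrix_diff_distrib transpose_linear matrix_mul_assoc matrix_transpose_mul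

lemma sum_UNIV_Plus:
  fixes f :: "'n::finite + 'k::finite \<Rightarrow> 'a::comm_monoid_add"
  shows "sum f UNIV = (\<Sum>a\<in>UNIV. f (Inl a)) + (\<Sum>b\<in>UNIV. f (Inr b))"
  using sum.Plus[of "UNIV :: 'n set" "UNIV :: 'k set" f] by simp

lemma prod_UNIV_Plus:
  fixes f :: "'n::finite + 'k::finite \<Rightarrow> 'a::comm_monoid_mult"
  shows "prod f UNIV = (\<Prod>a\<in>UNIV. f (Inl a)) * (\<Prod>b\<in>UNIV. f (Inr b))"
  using prod.Plus[of "UNIV :: 'n set" "UNIV :: 'k set" f] by simp

lemma block_matrix_component [simp]:
  "block_matrix A B C E $ Inl a $ Inl b = A $ a $ b"
  "block_matrix A B C E $ Inl a $ Inr d = B $ a $ d"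
  "block_matrix A B C E $ Inr c $ Inl b = C $ c $ b"
  "block_matrix A B C E $ Inr c $ Inr d = E $ c $ d"
  by (simp_all add: block_matrix_def)

lemma block_matrix_eq_iff:
  "block_matrix A B C E = block_matrix A' B' C' E' \<longleftrightarrow> A = A' \<and> B = B' \<and> C = C' \<and> E = E'"
  by (auto simp: vec_eq_iff split_sum_all)

lemma block_matrix_cases:
  fixes M :: "real^('n::finite + 'k::finite)^('n + 'k)"
  obtains A B C E where "M = block_matrix A B C E"
proof
  show "M = block_matrix (\<chi> i j. M $ Inl i $ Inl j) (\<chi> i j. M $ Inl i $ Inr j)
      (\<chi> i j. M $ Inr i $ Inl j) (\<chi> i j. M $ Inr i $ Inr j)"
    by (simp add: vec_eq_iff split_sum_all)
qed

lemma block_matrix_mult: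
  "block_matrix A B C E ** block_matrix A' B' C' E' =
    block_matrix (A ** A' + B ** C') (A ** B' + B ** E') (C ** A' + E ** C') (C ** B' + E ** E')"
  by (simp add: vec_eq_iff split_sum_all matrix_matrix_mult_def sum_UNIV_Plus)

lemma block_matrix_diff:
  "block_matrix A B C E - block_matrix A' B' C' E' = block_matrix (A - A') (B - B') (C - C') (E - E')"
  by (simp add: vec_eq_iff split_sum_all)

lemma transpose_block_matrix:
  "transpose (block_matrix A B C E) = block_matrix (transpose A) (transpose C) (transpose B) (transpose E)"
  by (simp add: vec_eq_iff split_sum_all transpose_def)

lemma block_matrix_mat_1: "block_matrix (mat 1) 0 0 (mat 1) = mat 1"
  by (simp add: vec_eq_iff split_sum_all mat_def)

lemma trace_block_matrix: "trace (block_matrix A B C E) = trace A + trace E"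
  by (simp add: trace_def sum_UNIV_Plus)

lemma upper_left_block_matrix [simp]: "upper_left (block_matrix A B C E) = A"
  by (simp add: upper_left_def vec_eq_iff)

lemma pos_def_block_diag_iff:
  fixes A :: "real^'n^'n" and E :: "real^'k^'k"
  shows "pos_def (block_matrix A 0 0 E) \<longleftrightarrow> pos_def A \<and> pos_def E"
proof -
  define q where "q x = x \<bullet> (block_matrix A 0 0 E *v x)" for x
  have q: "q x = (\<chi> i. x $ Inl i) \<bullet> (A *v (\<chi> i. x $ Inl i)) + (\<chi> i. x $ Inr i) \<bullet> (E *v (\<chi> i. x $ Inr i))" for x
    by (simp add: q_def inner_vec_def matrix_vector_mult_def sum_UNIV_Plus)
  have ex: "\<exists>x. (\<chi> i. x $ Inl i) = y \<and> (\<chi> i. x $ Inr i) = z" for y :: "real^'n" and z :: "real^'k"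
    by (rule exI[of _ "\<chi> i. case i of Inl a \<Rightarrow> y $ a | Inr b \<Rightarrow> z $ b"]) (simp add: vec_eq_iff)
  have 0: "x = 0 \<longleftrightarrow> (\<chi> i. x $ Inl i) = (0 :: real^'n) \<and> (\<chi> i. x $ Inr i) = (0 :: real^'k)" for x :: "real^('n+'k)"
    by (simp add: vec_eq_iff split_sum_all)
  have sym: "transpose (block_matrix A 0 0 E) = block_matrix A 0 0 E \<longleftrightarrow> transpose A = A \<and> transpose E = E"
    by (simp add: transpose_block_matrix block_matrix_eq_iff transpose_linear)
  show ?thesis
  proof
    assume *: "pos_def (block_matrix A 0 0 E)"
    then have pos: "q x > 0" if "x \<noteq> 0" for x using that by (simp add: pos_def_def q_def)
    have "y \<bullet> (A *v y) > 0" if "y \<noteq> 0" for y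
    proof -
      obtain x where x: "(\<chi> i. x $ Inl i) = y" "(\<chi> i. x $ Inr i) = (0 :: real^'k)" using ex by blast
      have "x \<noteq> 0" using x(1) that 0 by metis
      from pos[OF this] show ?thesis unfolding q x by simp
    qed
    moreover have "z \<bullet> (E *v z) > 0" if "z \<noteq> 0" for z
    proof -
      obtain x where x: "(\<chi> i. x $ Inl i) = (0 :: real^'n)" "(\<chi> i. x $ Inr i) = z" using ex by blast
      have "x \<noteq> 0" using x(2) that 0 by metis
      from pos[OF this] show ?thesis unfolding q x by simp
    qed
    ultimately show "pos_def A \<and> pos_def E" using * sym by (simp add: pos_def_def)
  next
    assume *: "pos_def A \<and> pos_def E"
    then have A: "y \<bullet> (A *v y) > 0 \<or> y = 0" and E: "z \<bullet> (E *v z) > 0 \<or> z = 0" for y z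
      by (auto simp: pos_def_def)
    have "q x > 0" if "x \<noteq> 0" for x
      using that A[of "\<chi> i. x $ Inl i"] E[of "\<chi> i. x $ Inr i"] unfolding q 0 by auto
    then show "pos_def (block_matrix A 0 0 E)" using * sym by (simp add: pos_def_def q_def)
  qed
qed

text \<open>
  Diagonalizing \<open>A\<close> by an orthogonal congruence, padded with an identity block, diagonalizes the block
  matrix without changing either determinant, so the claim reduces to diagonal matrices.
\<close>

lemma det_block_diag_1:
  fixes A :: "real^'n^'n"
  assumes A: "pos_def A"
  shows "det (block_matrix A 0 0 (mat 1 :: real^'k^'k)) = det A"
proof -
  obtain P :: "real^'n^'n" and d where P: "invertible P" "transpose P ** mat 1 ** P = mat 1"
    "transpose P ** A ** P = (\<chi> i j. if i = j then d i else 0)" (is "_ = ?D")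
    by (rule simultaneous_diagonalization[OF pos_def_mat_1 pos_def_symmetric[OF A]])
  define B :: "real^('n+'k)^('n+'k)" where "B = block_matrix P 0 0 (mat 1)"
  have "det P * det P = 1" using arg_cong[OF P(2), of det] by (simp add: det_mul)
  then have "det A = det P * det A * det P" by (simp add: mult_ac)
  also have "\<dots> = det ?D" using arg_cong[OF P(3), of det] by (simp add: det_mul)
  also have "\<dots> = (\<Prod>i\<in>UNIV. d i)" by (subst det_diagonal) auto
  finally have detA: "det A = (\<Prod>i\<in>UNIV. d i)" .
  have "transpose B ** B = mat 1" using P(2)
    by (simp add: B_def transpose_block_matrix block_matrix_mult transpose_linear block_matrix_mat_1)
  from arg_cong[OF this, of det] have "det B * det B = 1" by (simp add: det_mul)
  then have "det (block_matrix A 0 0 (mat 1 :: real^'k^'k)) = det (transpose B ** block_matrix A 0 0 (mat 1) ** B)"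
    by (simp add: det_mul mult_ac)
  also have "transpose B ** block_matrix A 0 0 (mat 1) ** B = block_matrix ?D 0 0 (mat 1)"
    using P(3) by (simp add: B_def transpose_block_matrix block_matrix_mult transpose_linear)
  also have "det \<dots> = (\<Prod>i\<in>UNIV. \<dots> $ i $ i)"
  proof (rule det_diagonal)
    show "block_matrix ?D 0 0 (mat 1 :: real^'k^'k) $ i $ j = 0" if "i \<noteq> j" for i j
      using that by (cases i; cases j) (auto simp: mat_def)
  qed
  also have "\<dots> = (\<Prod>i\<in>UNIV. d i)" by (simp add: prod_UNIV_Plus mat_def)
  finally show ?thesis using detA by simp
qed

section \<open>First partial minimization: changing the marginal\<close>

text \<open>
  The covariance of a pair \<open>(Y, Z)\<close> where \<open>Y\<close> has covariance \<open>A\<close> and \<open>Z\<close> is the linear regression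
  \<open>transpose X *v Y\<close> plus independent noise of covariance \<open>E\<close>. Varying \<open>A\<close> with \<open>X\<close> and \<open>E\<close> fixed
  changes the law of \<open>Y\<close> and keeps the conditional law of \<open>Z\<close> given \<open>Y\<close>.
\<close>

definition regression_block :: "real^'n^'n \<Rightarrow> real^'k^'n \<Rightarrow> real^'k^'k \<Rightarrow> real^('n + 'k)^('n + 'k)" where
  "regression_block A X E =
     block_matrix A (A ** X) (transpose X ** A) (E + transpose X ** A ** X)"

lemma regression_block_factor:
  "regression_block A X E =
    transpose (block_matrix (mat 1) X 0 (mat 1)) ** block_matrix A 0 0 E ** block_matrix (mat 1) X 0 (mat 1)"
  by (simp add: regression_block_def transpose_block_matrix block_matrix_mult transpose_linear add.commute)

lemma shear_inverse:
  "block_matrix (mat 1) X 0 (mat 1) ** block_matrix (mat 1) (- X) 0 (mat 1) = mat 1"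
  by (simp add: block_matrix_mult block_matrix_mat_1)

lemma shear_invertible: "invertible (block_matrix (mat 1) X 0 (mat 1))"
  using shear_inverse invertible_right_inverse by blast

lemma pos_def_regression_block_iff:
  "pos_def (regression_block A X E) \<longleftrightarrow> pos_def A \<and> pos_def E"
  unfolding regression_block_factor pos_def_congruence[OF shear_invertible] pos_def_block_diag_iff ..

text \<open>
  The constant \<open>c\<close> depends on \<open>X\<close> and \<open>E\<close> only, so determinant ratios of two such matrices with common
  \<open>X\<close> and \<open>E\<close> equal those of the marginals.
\<close>

lemma det_regression_block:
  fixes X :: "real^'k^'n" and E :: "real^'k^'k"
  obtains c where "\<And>A. pos_def A \<Longrightarrow> det (regression_block A X E) = c * det A"
proof
  let ?U = "block_matrix (mat 1) X 0 (mat 1)"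
  fix A :: "real^'n^'n" assume A: "pos_def A"
  have "block_matrix A 0 0 E = block_matrix A 0 0 (mat 1) ** block_matrix (mat 1) 0 0 E"
    by (simp add: block_matrix_mult)
  then have "det (block_matrix A 0 0 E) = det A * det (block_matrix (mat 1 :: real^'n^'n) 0 0 E)"
    using det_block_diag_1[OF A, where ?'k = 'k] by (simp add: det_mul)
  then show "det (regression_block A X E)
      = (det ?U * det (block_matrix (mat 1 :: real^'n^'n) 0 0 E) * det ?U) * det A"
    by (simp add: regression_block_factor det_mul)
qed

lemma matrix_inv_congruence:
  fixes A U :: "real^'m^'m"
  assumes "invertible U" "invertible A"
  shows "matrix_inv (transpose U ** A ** U) = matrix_inv U ** matrix_inv A ** transpose (matrix_inv U)"
  using assms
  by (simp add: matrix_inv_matrix_mult transpose_invertible invertible_mult transpose_matrix_inv matrix_mul_assoc)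

lemma matrix_inv_block_diag:
  assumes "invertible A" "invertible E"
  shows "matrix_inv (block_matrix A 0 0 E) = block_matrix (matrix_inv A) 0 0 (matrix_inv E)"
  by (rule matrix_inv_eqI) (simp add: assms block_matrix_mult block_matrix_mat_1)

text \<open>
  The inverse is the inverse of \<open>A\<close> in the upper left corner plus a matrix that depends on \<open>X\<close> and \<open>E\<close> only;
  the latter contributes the constant \<open>c\<close>.
\<close>

lemma trace_regression_block:
  fixes X :: "real^'k^'n" and E :: "real^'k^'k" and M :: "real^('n + 'k)^('n + 'k)"
  assumes E: "pos_def E"
  obtains c where "\<And>A. pos_def A \<Longrightarrow>
    trace (matrix_inv (regression_block A X E) ** M) = trace (matrix_inv A ** upper_left M) + c"
proof -
  obtain N1 N2 N3 N4 where M: "M = block_matrix N1 N2 N3 N4" by (rule block_matrix_cases)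
  let ?U = "block_matrix (mat 1) X 0 (mat 1)" and ?V = "block_matrix (mat 1) (- X) 0 (mat 1)"
  have V: "matrix_inv ?U = ?V" by (rule matrix_inv_eqI[OF shear_inverse])
  show ?thesis
  proof (rule that)
    fix A :: "real^'n^'n" assume A: "pos_def A"
    have "pos_def (block_matrix A 0 0 E)" using A E by (simp add: pos_def_block_diag_iff)
    then have "matrix_inv (regression_block A X E) ** M
        = ?V ** (block_matrix (matrix_inv A) 0 0 (matrix_inv E) ** transpose ?V ** M)"
      unfolding regression_block_factor
      using A E by (simp add: matrix_inv_congruence shear_invertible matrix_inv_block_diag V matrix_mul_assoc)
    then have "trace (matrix_inv (regression_block A X E) ** M)
        = trace (block_matrix (matrix_inv A) 0 0 (matrix_inv E) ** (transpose ?V ** M ** ?V))"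
      using trace_mul_sym[of ?V "block_matrix (matrix_inv A) 0 0 (matrix_inv E) ** transpose ?V ** M"]
      by (simp add: matrix_mul_assoc)
    also have "\<dots> = trace (matrix_inv A ** upper_left M)
        + trace (matrix_inv E ** (N4 - N3 ** X - transpose X ** N2 + transpose X ** N1 ** X))"
      by (simp add: M transpose_block_matrix block_matrix_mult trace_block_matrix matrix_algebra algebra_simps)
    finally show "trace (matrix_inv (regression_block A X E) ** M) = \<dots>" .
  qed
qed

text \<open>
  First Pythagorean identity. The determinants and the traces of the two block matrices differ only through
  their marginals \<open>S\<close> and \<open>S0\<close>, and the marginal of \<open>M\<close> is \<open>S0\<close>; the difference of the two divergences
  is therefore a divergence of marginals.
\<close>

lemma I_div_regression_block:
  fixes S S0 :: "real^'n^'n" and X :: "real^'k^'n"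
  assumes S: "pos_def S" and S0: "pos_def S0" and E: "pos_def E"
    and M: "pos_def M" "upper_left M = S0"
  shows "I_div M (regression_block S X E) = I_div M (regression_block S0 X E) + I_div S0 S"
proof -
  obtain c where c: "\<And>A. pos_def A \<Longrightarrow> det (regression_block A X E) = c * det A"
    by (rule det_regression_block[of X E]) blast
  obtain e where e: "\<And>A. pos_def A \<Longrightarrow>
    trace (matrix_inv (regression_block A X E) ** M) = trace (matrix_inv A ** upper_left M) + e"
    by (rule trace_regression_block[OF E, of X M]) blast
  have pos: "det S > 0" "det S0 > 0" "det M > 0" using S S0 M pos_def_det_pos by auto
  have "det (regression_block S0 X E) > 0"
    using S0 E by (intro pos_def_det_pos) (simp add: pos_def_regression_block_iff)
  then have "c > 0" using c[OF S0] pos by (simp add: zero_less_mult_iff)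
  then have "ln (det (regression_block S X E) / det M)
      = ln (det (regression_block S0 X E) / det M) + ln (det S / det S0)"
    using pos by (simp add: c S S0 ln_div ln_mult)
  moreover have "trace (matrix_inv S0 ** S0) = real CARD('n)" using S0 by (simp add: trace_I)
  ultimately show ?thesis by (simp add: I_div_def e S S0 M(2) algebra_simps add_divide_distrib)
qed

text \<open>
  In the Pythagorean identity the term \<open>I_div S0 S\<close> is constant over the candidates, and the other one is
  nonnegative and vanishes only at the claimed minimizer.
\<close>

lemma first_partial_min_regression_block_iff:
  fixes S S0 :: "real^'n^'n" and X :: "real^'k^'n"
  assumes S: "pos_def S" and S0: "pos_def S0" and E: "pos_def E"
  shows "is_first_partial_min S0 (regression_block S X E) M \<longleftrightarrow> M = regression_block S0 X E"
proof -
  let ?M0 = "regression_block S0 X E" and ?S = "regression_block S X E"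
  have pd: "pos_def ?M0" using S0 E by (simp add: pos_def_regression_block_iff)
  have M0: "?M0 \<in> Sigma0_set S0" using pd by (simp add: Sigma0_set_def) (simp add: regression_block_def)
  have split: "I_div N ?S = I_div N ?M0 + I_div S0 S" if "N \<in> Sigma0_set S0" for N
    using I_div_regression_block[OF S S0 E] that by (simp add: Sigma0_set_def)
  have nn: "I_div N ?M0 \<ge> 0" if "N \<in> Sigma0_set S0" for N
    using I_div_nonneg[OF _ pd] that by (simp add: Sigma0_set_def)
  have z: "I_div ?M0 ?M0 = 0" using pd by (simp add: I_div_def trace_I pos_def_det_pos less_imp_neq[symmetric])
  show ?thesis
  proof
    assume "is_first_partial_min S0 ?S M"
    then have M: "M \<in> Sigma0_set S0" "\<not> I_div ?M0 ?S < I_div M ?S"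
      using M0 by (auto simp: is_first_partial_min_def is_arg_min_def)
    then have "I_div M ?M0 = 0" using split[OF M(1)] split[OF M0] nn[OF M(1)] z by simp
    then show "M = ?M0" using I_div_eq_0_imp_eq[OF _ pd] M(1) by (simp add: Sigma0_set_def)
  next
    assume "M = ?M0"
    moreover have "\<not> I_div N ?S < I_div ?M0 ?S" if "N \<in> Sigma0_set S0" for N
      using split[OF that] split[OF M0] nn[OF that] z by simp
    ultimately show "is_first_partial_min S0 ?S M"
      using M0 by (auto simp: is_first_partial_min_def is_arg_min_def)
  qed
qed

section \<open>Second partial minimization: the factor analysis structure\<close>

text \<open>
  Second Pythagorean identity, in abstract form: the log-determinants telescope, and the two trace
  conditions allow \<open>M\<close> to be replaced by \<open>A\<close> inside both traces.
\<close>

lemma I_div_pythagoras: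
  fixes M A B :: "real^'m^'m"
  assumes "pos_def M" "pos_def A" "pos_def B"
    and "trace (matrix_inv A ** (M - A)) = 0" "trace (matrix_inv B ** (M - A)) = 0"
  shows "I_div M B = I_div M A + I_div A B"
proof -
  have pos: "det M > 0" "det A > 0" "det B > 0" using assms pos_def_det_pos by auto
  have "trace (matrix_inv A ** M) = real CARD('m)" "trace (matrix_inv B ** M) = trace (matrix_inv B ** A)"
    using assms by (simp_all add: matrix_diff_distrib trace_sub trace_I)
  then show ?thesis using pos by (simp add: I_div_def ln_div algebra_simps add_divide_distrib diff_divide_distrib)
qed

text \<open>
  The dual description of a joint covariance, by the covariance \<open>transpose Q ** Q\<close> of the hidden factors
  and the covariance \<open>A - H ** transpose H\<close> of the observations given the factors. With
  \<open>A = fa_cov H D\<close> it is \<open>Sigma_HDQ H D Q\<close>, and the conditional covariance is \<open>D\<close>.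
\<close>

definition hidden_block :: "real^'n^'n \<Rightarrow> real^'k^'n \<Rightarrow> real^'k^'k \<Rightarrow> real^('n + 'k)^('n + 'k)" where
  "hidden_block A H Q = block_matrix A (H ** Q) (transpose (H ** Q)) (transpose Q ** Q)"

lemma hidden_block_factor:
  "hidden_block A H Q = transpose (block_matrix (mat 1) 0 (transpose H) Q)
     ** block_matrix (A - H ** transpose H) 0 0 (mat 1) ** block_matrix (mat 1) 0 (transpose H) Q"
  by (simp add: hidden_block_def transpose_block_matrix block_matrix_mult matrix_algebra)

lemma hidden_factor_inverse:
  assumes "invertible Q"
  shows "block_matrix (mat 1) 0 (transpose H) Q
     ** block_matrix (mat 1) 0 (- (matrix_inv Q ** transpose H)) (matrix_inv Q) = mat 1"
  using assms by (simp add: block_matrix_mult matrix_algebra block_matrix_mat_1)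

lemma hidden_factor_invertible:
  assumes "invertible Q"
  shows "invertible (block_matrix (mat 1) 0 (transpose H) Q)"
  using hidden_factor_inverse[OF assms] invertible_right_inverse by blast

lemma pos_def_hidden_block_iff:
  assumes "invertible Q"
  shows "pos_def (hidden_block A H Q) \<longleftrightarrow> pos_def (A - H ** transpose H)"
  unfolding hidden_block_factor pos_def_congruence[OF hidden_factor_invertible[OF assms]]
    pos_def_block_diag_iff by (simp add: pos_def_mat_1)

text \<open>
  The upper left block of the inverse of a joint covariance is the inverse of the conditional covariance.
\<close>

lemma trace_hidden_block:
  fixes A N :: "real^'n^'n" and H :: "real^'k^'n" and Q :: "real^'k^'k"
  assumes Q: "invertible Q" and D: "pos_def (A - H ** transpose H)"
  shows "trace (matrix_inv (hidden_block A H Q) ** block_matrix N 0 0 0)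
    = trace (matrix_inv (A - H ** transpose H) ** N)"
proof -
  let ?U = "block_matrix (mat 1) 0 (transpose H) Q"
    and ?V = "block_matrix (mat 1) 0 (- (matrix_inv Q ** transpose H)) (matrix_inv Q)"
    and ?D = "A - H ** transpose H" and ?N = "block_matrix N 0 0 0"
  have V: "matrix_inv ?U = ?V" by (rule matrix_inv_eqI[OF hidden_factor_inverse[OF Q]])
  have "pos_def (block_matrix ?D 0 0 (mat 1 :: real^'k^'k))" using D pos_def_mat_1 by (simp add: pos_def_block_diag_iff)
  then have "matrix_inv (hidden_block A H Q) ** ?N
      = ?V ** (block_matrix (matrix_inv ?D) 0 0 (matrix_inv (mat 1)) ** transpose ?V ** ?N)"
    unfolding hidden_block_factor
    using D pos_def_invertible[OF pos_def_mat_1, where ?'a = 'k]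
    by (simp add: matrix_inv_congruence hidden_factor_invertible[OF Q] matrix_inv_block_diag V matrix_mul_assoc)
  then have "trace (matrix_inv (hidden_block A H Q) ** ?N)
      = trace (block_matrix (matrix_inv ?D) 0 0 (matrix_inv (mat 1)) ** (transpose ?V ** ?N ** ?V))"
    using trace_mul_sym[of ?V "block_matrix (matrix_inv ?D) 0 0 (matrix_inv (mat 1)) ** transpose ?V ** ?N"]
    by (simp add: matrix_mul_assoc)
  also have "transpose ?V ** ?N ** ?V = ?N"
    by (simp add: transpose_block_matrix block_matrix_mult transpose_linear)
  finally show ?thesis by (simp add: block_matrix_mult trace_block_matrix trace_def[of 0])
qed

lemma pos_def_diagonal_iff:
  fixes D :: "real^'m^'m"
  assumes "is_diagonal D"
  shows "pos_def D \<longleftrightarrow> (\<forall>i. D $ i $ i > 0)"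
proof (intro iffI allI)
  assume pos: "\<forall>i. D $ i $ i > 0"
  have "D *v x = (\<chi> i. D $ i $ i * x $ i)" for x
  proof -
    have "(\<Sum>j\<in>UNIV. D $ i $ j * x $ j) = (\<Sum>j\<in>UNIV. if j = i then D $ i $ i * x $ i else 0)" for i
      using assms by (intro sum.cong) (auto simp: is_diagonal_def)
    then show ?thesis by (simp add: matrix_vector_mult_def vec_eq_iff)
  qed
  then have q: "x \<bullet> (D *v x) = (\<Sum>i\<in>UNIV. D $ i $ i * (x $ i)\<^sup>2)" for x
    by (simp add: inner_vec_def power2_eq_square mult_ac)
  have "x \<bullet> (D *v x) > 0" if "x \<noteq> 0" for x
  proof -
    obtain i where "x $ i \<noteq> 0" using \<open>x \<noteq> 0\<close> by (auto simp: vec_eq_iff)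
    then show ?thesis unfolding q using pos
      by (intro sum_pos2[of _ i]) (auto simp: less_imp_le)
  qed
  moreover have "transpose D = D"
    using assms by (simp add: vec_eq_iff transpose_def is_diagonal_def) metis
  ultimately show "pos_def D" by (simp add: pos_def_def)
qed (rule pos_def_diagonal_pos)

text \<open>
  This orthogonality explains why \<open>D\<close> is updated by a diagonal part: what the update neglects has zero
  diagonal and is invisible to the inverse of a diagonal matrix.
\<close>

lemma trace_diagonal_inverse_zero_diagonal:
  fixes D N :: "real^'m^'m"
  assumes D: "is_diagonal D" "pos_def D" and N: "\<And>i. N $ i $ i = 0"
  shows "trace (matrix_inv D ** N) = 0"
proof -
  have pos: "D $ i $ i > 0" for i using pos_def_diagonal_pos[OF D(2)] .
  let ?I = "\<chi> i j. if i = j then 1 / D $ i $ i else 0"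
  have "(D ** ?I) $ i $ j = (\<Sum>k\<in>UNIV. if k = j then D $ i $ j / D $ j $ j else 0)" for i j
    unfolding matrix_matrix_mult_def vec_lambda_beta by (rule sum.cong) auto
  then have "(D ** ?I) $ i $ j = mat 1 $ i $ j" for i j
    using D(1) pos[of j] by (auto simp: mat_def is_diagonal_def)
  then have inv: "matrix_inv D = ?I" by (intro matrix_inv_eqI) (simp add: vec_eq_iff)
  have "(?I ** N) $ i $ i = (\<Sum>k\<in>UNIV. if k = i then N $ i $ i / D $ i $ i else 0)" for i
    unfolding matrix_matrix_mult_def vec_lambda_beta by (rule sum.cong) auto
  then show ?thesis unfolding inv trace_def by (simp add: N)
qed

section \<open>One iteration of the algorithm\<close>

lemma pos_def_add_congruence:
  fixes E :: "real^'k^'k" and S :: "real^'n^'n" and X :: "real^'k^'n"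
  assumes E: "pos_def E" and S: "pos_def S"
  shows "pos_def (E + transpose X ** S ** X)"
proof -
  have nn: "y \<bullet> (S *v y) \<ge> 0" for y
    using S by (cases "y = 0") (auto simp: pos_def_def less_imp_le)
  have q: "x \<bullet> ((E + transpose X ** S ** X) *v x) = x \<bullet> (E *v x) + (X *v x) \<bullet> (S *v (X *v x))" for x
    using dot_lmul_matrix[of x "transpose X" "S *v (X *v x)"]
    by (simp add: matrix_vector_mult_add_rdistrib inner_add_right matrix_vector_mul_assoc matrix_mul_assoc
        del: transpose_matrix_vector)
  have "transpose (E + transpose X ** S ** X) = E + transpose X ** S ** X"
    using E S by (simp add: matrix_algebra pos_def_symmetric)
  moreover have "x \<bullet> ((E + transpose X ** S ** X) *v x) > 0" if "x \<noteq> 0" for x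
    using E that nn[of "X *v x"] unfolding q by (auto simp: pos_def_def intro: add_pos_nonneg)
  ultimately show ?thesis by (simp add: pos_def_def)
qed

lemma pos_def_fa_cov: "pos_def D \<Longrightarrow> pos_def (fa_cov H D)"
  using pos_def_add_congruence[OF _ pos_def_mat_1, of D "transpose H"]
  by (simp add: fa_cov_def add.commute)

text \<open>
  For the joint covariance \<open>Sigma_HDQ H D Q\<close>: the coefficients of the regression of the hidden factors on the
  observations, and the covariance of the factors given the observations.
\<close>

definition regression_coeff :: "real^'k^'n \<Rightarrow> real^'n^'n \<Rightarrow> real^'k^'k \<Rightarrow> real^'k^'n" where
  "regression_coeff H D Q = matrix_inv (fa_cov H D) ** H ** Q"

definition residual_cov :: "real^'k^'n \<Rightarrow> real^'n^'n \<Rightarrow> real^'k^'k \<Rightarrow> real^'k^'k" where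
  "residual_cov H D Q = transpose Q ** Q - transpose (H ** Q) ** regression_coeff H D Q"

lemma Sigma_HDQ_hidden: "Sigma_HDQ H D Q = hidden_block (fa_cov H D) H Q"
  by (simp add: Sigma_HDQ_def hidden_block_def)

lemma Sigma_HDQ_regression:
  assumes "pos_def D"
  shows "Sigma_HDQ H D Q = regression_block (fa_cov H D) (regression_coeff H D Q) (residual_cov H D Q)"
proof -
  have S: "invertible (fa_cov H D)" "transpose (fa_cov H D) = fa_cov H D"
    using pos_def_fa_cov[OF assms, of H] by (auto simp: pos_def_symmetric)
  have 1: "fa_cov H D ** regression_coeff H D Q = H ** Q"
    using S by (simp add: regression_coeff_def matrix_mul_assoc)
  then have 2: "transpose (regression_coeff H D Q) ** fa_cov H D = transpose (H ** Q)"
    using S(2) by (metis matrix_transpose_mul)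
  show ?thesis by (simp add: Sigma_HDQ_def regression_block_def 1 2 residual_cov_def)
qed

lemma pos_def_Sigma_HDQ:
  assumes "pos_def D" "invertible Q"
  shows "pos_def (Sigma_HDQ H D Q)"
  using assms by (simp add: Sigma_HDQ_hidden pos_def_hidden_block_iff) (simp add: fa_cov_def)

lemma pos_def_residual_cov:
  assumes "pos_def D" "invertible Q"
  shows "pos_def (residual_cov H D Q)"
  using pos_def_Sigma_HDQ[OF assms] unfolding Sigma_HDQ_regression[OF assms(1)] pos_def_regression_block_iff ..

text \<open>
  This is the lower right block of the first partial minimizer, which identifies the matrix \<open>R_update\<close>
  of the algorithm and yields its positivity.
\<close>

lemma R_update_congruence:
  assumes D: "pos_def D"
  shows "transpose Q ** R_update S0 H D ** Q = residual_cov H D Q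
     + transpose (regression_coeff H D Q) ** S0 ** regression_coeff H D Q"
proof -
  have S: "invertible (fa_cov H D)" "transpose (fa_cov H D) = fa_cov H D"
    using pos_def_fa_cov[OF assms, of H] by (auto simp: pos_def_symmetric)
  show ?thesis
    by (simp add: R_update_def residual_cov_def regression_coeff_def matrix_algebra
        transpose_matrix_inv S)
qed

lemma pos_def_R_update:
  assumes S0: "pos_def S0" and D: "pos_def D"
  shows "pos_def (R_update S0 H D)"
  using R_update_congruence[OF D, of "mat 1" S0 H]
    pos_def_add_congruence[OF pos_def_residual_cov[OF D, of "mat 1"] S0]
  by (simp add: pos_def_mat_1)

lemma first_partial_min_iff:
  assumes "pos_def S0" "pos_def D" "invertible Q"
  shows "is_first_partial_min S0 (Sigma_HDQ H D Q) M \<longleftrightarrow>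
    M = regression_block S0 (regression_coeff H D Q) (residual_cov H D Q)"
  unfolding Sigma_HDQ_regression[OF assms(2)]
  by (intro first_partial_min_regression_block_iff pos_def_fa_cov pos_def_residual_cov assms)

text \<open>
  The next value of \<open>H ** transpose H\<close>. In contrast to the next \<open>H\<close> it does not depend on the choice of
  a square root, and it is a continuous function of \<open>H\<close> and \<open>D\<close>.
\<close>

definition next_HHT :: "real^'n^'n \<Rightarrow> real^'k^'n \<Rightarrow> real^'n^'n \<Rightarrow> real^'n^'n" where
  "next_HHT S0 H D = S0 ** matrix_inv (fa_cov H D) ** H ** matrix_inv (R_update S0 H D)
     ** transpose H ** matrix_inv (fa_cov H D) ** S0"

definition next_cov :: "real^'n^'n \<Rightarrow> real^'k^'n \<Rightarrow> real^'n^'n \<Rightarrow> real^'n^'n" where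
  "next_cov S0 H D = next_HHT S0 H D + diag_part (S0 - next_HHT S0 H D)"

text \<open>
  One iteration as a property of a single transition, with an arbitrary square root \<open>W\<close>. It applies to each
  step of a run and also to a transition started at a limit point, which belongs to no run.
\<close>

locale fa_step =
  fixes S0 D D' :: "real^'n^'n" and H H' :: "real^'k^'n" and Q Q' W :: "real^'k^'k"
  assumes S0: "pos_def S0"
    and D: "pos_def D" "is_diagonal D"
    and Q: "invertible Q"
    and W: "transpose W ** W = R_update S0 H D"
    and H': "H' = S0 ** matrix_inv (fa_cov H D) ** H ** matrix_inv W"
    and D': "D' = diag_part (S0 - H' ** transpose H')"
    and Q': "Q' = W ** Q"
begin

lemma fa_cov_invertible: "invertible (fa_cov H D)"
  using pos_def_fa_cov[OF D(1), of H] by simp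

lemma W_invertible: "invertible W"
proof -
  have "det W * det W > 0"
    using arg_cong[OF W, of det] pos_def_det_pos[OF pos_def_R_update[OF S0 D(1), of H]]
    by (simp add: det_mul)
  then show ?thesis by (auto simp: invertible_det_nz)
qed

lemma Q'_invertible: "invertible Q'"
  using W_invertible Q by (simp add: Q' invertible_mult)

lemma HHT_step: "H' ** transpose H' = next_HHT S0 H D"
proof -
  have "matrix_inv (R_update S0 H D) = matrix_inv W ** transpose (matrix_inv W)"
    using W_invertible matrix_inv_congruence[of W "mat 1"]
    by (simp add: pos_def_mat_1 flip: W)
  moreover have "transpose (matrix_inv (fa_cov H D)) = matrix_inv (fa_cov H D)"
    using fa_cov_invertible pos_def_fa_cov[OF D(1), of H] by (simp add: transpose_matrix_inv pos_def_symmetric)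
  ultimately show ?thesis
    using pos_def_symmetric[OF S0] by (simp add: next_HHT_def H' matrix_transpose_mul matrix_mul_assoc)
qed

lemma fa_cov_step: "fa_cov H' D' = next_cov S0 H D"
  by (simp add: fa_cov_def next_cov_def D' HHT_step)

text \<open>
  The solution of the first partial minimization is a joint covariance with the new \<open>H'\<close> and \<open>Q'\<close>, in which
  the observations keep the covariance \<open>S0\<close>. Its positive definiteness gives that of
  \<open>S0 - H' ** transpose H'\<close>, from which parts (a) and (d) follow.
\<close>

lemma first_min_hidden:
  "hidden_block S0 H' Q' = regression_block S0 (regression_coeff H D Q) (residual_cov H D Q)"
proof -
  have 1: "H' ** Q' = S0 ** regression_coeff H D Q"
    using W_invertible by (simp add: H' Q' regression_coeff_def matrix_mul_assoc)
  then have 2: "transpose (H' ** Q') = transpose (regression_coeff H D Q) ** S0"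
    using pos_def_symmetric[OF S0] by (simp add: matrix_transpose_mul)
  have "transpose Q' ** Q' = transpose Q ** (transpose W ** W) ** Q"
    by (simp add: Q' matrix_algebra)
  then show ?thesis
    unfolding hidden_block_def regression_block_def 2 unfolding 1
    by (simp add: W R_update_congruence[OF D(1)])
qed

lemma residual_pos_def: "pos_def (S0 - H' ** transpose H')"
proof -
  have "pos_def (hidden_block S0 H' Q')"
    unfolding first_min_hidden using S0 D(1) Q
    by (simp add: pos_def_regression_block_iff pos_def_residual_cov)
  then show ?thesis by (simp add: pos_def_hidden_block_iff[OF Q'_invertible])
qed

lemma D'_diagonal: "is_diagonal D'"
  by (simp add: D' is_diagonal_def diag_part_def)

lemma D'_pos_def: "pos_def D'"
  using pos_def_diagonal_pos[OF residual_pos_def]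
  by (simp add: pos_def_diagonal_iff[OF D'_diagonal]) (simp add: D' diag_part_def)

lemma D'_le: "D' $ i $ i \<le> S0 $ i $ i"
proof -
  have "(H' ** transpose H') $ i $ i \<ge> 0"
    by (simp add: matrix_matrix_mult_def transpose_def sum_nonneg)
  then show ?thesis by (simp add: D' diag_part_def)
qed

lemma HHT_psd_le: "psd_le (H' ** transpose H') S0"
proof -
  have "x \<bullet> ((S0 - H' ** transpose H') *v x) \<ge> 0" for x
    using residual_pos_def by (cases "x = 0") (auto simp: pos_def_def less_imp_le)
  then show ?thesis using residual_pos_def by (simp add: psd_le_def pos_semidef_def pos_def_def)
qed

lemma rank_step: "rank H' = rank H"
proof (rule order_antisym)
  have "H' = (S0 ** matrix_inv (fa_cov H D)) ** (H ** matrix_inv W)" by (simp add: H' matrix_mul_assoc)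
  then show "rank H' \<le> rank H"
    by (metis order_trans rank_mul_le_left rank_mul_le_right)
  have "H = (fa_cov H D ** matrix_inv S0) ** (H' ** W)"
    using S0 W_invertible fa_cov_invertible by (simp add: H' matrix_mul_assoc)
  then show "rank H \<le> rank H'"
    by (metis order_trans rank_mul_le_left rank_mul_le_right)
qed

text \<open>
  Old and new joint covariance both have a diagonal conditional covariance of the observations, \<open>D\<close> and \<open>D'\<close>.
  The first partial minimizer exceeds the new joint covariance by a matrix that is supported in the upper left
  block and has zero diagonal there; both trace conditions follow.
\<close>

lemma second_pythagoras:
  "I_div (hidden_block S0 H' Q') (Sigma_HDQ H D Q) =
     I_div (hidden_block S0 H' Q') (Sigma_HDQ H' D' Q') + I_div (Sigma_HDQ H' D' Q') (Sigma_HDQ H D Q)"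
proof (rule I_div_pythagoras)
  let ?N = "S0 - fa_cov H' D'"
  have diff: "hidden_block S0 H' Q' - Sigma_HDQ H' D' Q' = block_matrix ?N 0 0 0"
    by (simp add: Sigma_HDQ_hidden hidden_block_def block_matrix_diff)
  have N: "?N $ i $ i = 0" for i by (simp add: fa_cov_def D' diag_part_def)
  have cov: "fa_cov H D - H ** transpose H = D" "fa_cov H' D' - H' ** transpose H' = D'"
    by (simp_all add: fa_cov_def)
  show "pos_def (hidden_block S0 H' Q')" using residual_pos_def by (simp add: pos_def_hidden_block_iff Q'_invertible)
  show "pos_def (Sigma_HDQ H' D' Q')" using D'_pos_def Q'_invertible by (rule pos_def_Sigma_HDQ)
  show "pos_def (Sigma_HDQ H D Q)" using D(1) Q by (rule pos_def_Sigma_HDQ)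
  show "trace (matrix_inv (Sigma_HDQ H' D' Q') ** (hidden_block S0 H' Q' - Sigma_HDQ H' D' Q')) = 0"
    unfolding diff unfolding Sigma_HDQ_hidden
    using trace_hidden_block[OF Q'_invertible, of "fa_cov H' D'" H' ?N] D'_pos_def
      trace_diagonal_inverse_zero_diagonal[OF D'_diagonal D'_pos_def N] by (simp add: cov)
  show "trace (matrix_inv (Sigma_HDQ H D Q) ** (hidden_block S0 H' Q' - Sigma_HDQ H' D' Q')) = 0"
    unfolding diff unfolding Sigma_HDQ_hidden
    using trace_hidden_block[OF Q, of "fa_cov H D" H ?N] D
      trace_diagonal_inverse_zero_diagonal[OF D(2,1) N] by (simp add: cov)
qed

text \<open>
  Three Pythagorean identities combine: the minimizer \<open>hidden_block S0 H' Q'\<close> is compared with the old joint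
  covariance, with the new one, and with the minimizer of the following iteration.
\<close>

lemma I_div_step:
  "I_div S0 (fa_cov H D) = I_div S0 (fa_cov H' D') + I_div (Sigma_HDQ H' D' Q') (Sigma_HDQ H D Q)
    + I_div (hidden_block S0 H' Q')
        (regression_block S0 (regression_coeff H' D' Q') (residual_cov H' D' Q'))"
proof -
  let ?M = "hidden_block S0 H' Q'"
  have M: "pos_def ?M" "upper_left ?M = S0"
    using residual_pos_def by (simp_all add: pos_def_hidden_block_iff Q'_invertible) (simp add: hidden_block_def)
  have "I_div ?M (Sigma_HDQ H D Q) = I_div ?M ?M + I_div S0 (fa_cov H D)"
    unfolding Sigma_HDQ_regression[OF D(1)]
    by (subst (3) first_min_hidden) (intro I_div_regression_block pos_def_fa_cov pos_def_residual_cov D Q S0 M)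
  moreover have "I_div ?M ?M = 0" using M by (simp add: I_div_def trace_I pos_def_det_pos less_imp_neq[symmetric])
  moreover have "I_div ?M (Sigma_HDQ H' D' Q')
      = I_div ?M (regression_block S0 (regression_coeff H' D' Q') (residual_cov H' D' Q')) + I_div S0 (fa_cov H' D')"
    unfolding Sigma_HDQ_regression[OF D'_pos_def]
    by (intro I_div_regression_block pos_def_fa_cov pos_def_residual_cov D'_pos_def Q'_invertible S0 M)
  ultimately show ?thesis using second_pythagoras by simp
qed

lemma I_div_step_nonneg:
  "I_div (Sigma_HDQ H' D' Q') (Sigma_HDQ H D Q) \<ge> 0"
  "I_div (hidden_block S0 H' Q') (regression_block S0 (regression_coeff H' D' Q') (residual_cov H' D' Q')) \<ge> 0"
  using residual_pos_def S0 D(1) Q D'_pos_def Q'_invertible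
  by (auto intro!: I_div_nonneg pos_def_Sigma_HDQ
      simp: pos_def_hidden_block_iff pos_def_regression_block_iff pos_def_residual_cov)

lemma I_div_decreases: "I_div S0 (fa_cov H' D') \<le> I_div S0 (fa_cov H D)"
  using I_div_step I_div_step_nonneg by linarith

text \<open>
  If an iteration does not lower the objective, then the joint covariance does not move, so that
  \<open>S0 ** matrix_inv (fa_cov H D) ** H = H\<close>. The inverse of \<open>fa_cov H D\<close> is then eliminated through
  the identity \<open>fa_cov H D ** matrix_inv D ** H = H ** (mat 1 + transpose H ** matrix_inv D ** H)\<close>.
\<close>

lemma stationary_equation:
  assumes "I_div S0 (fa_cov H' D') = I_div S0 (fa_cov H D)"
  shows "H = (S0 - H ** transpose H) ** matrix_inv D ** H"
proof -
  let ?Si = "matrix_inv (fa_cov H D)"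
  have "I_div (Sigma_HDQ H' D' Q') (Sigma_HDQ H D Q) = 0"
    using assms I_div_step I_div_step_nonneg by linarith
  then have "Sigma_HDQ H' D' Q' = Sigma_HDQ H D Q"
    using D D'_pos_def Q Q'_invertible by (intro I_div_eq_0_imp_eq pos_def_Sigma_HDQ)
  then have "H' ** Q' = H ** Q" by (simp add: Sigma_HDQ_def block_matrix_eq_iff)
  then have "H' ** Q' ** matrix_inv Q = H ** Q ** matrix_inv Q" by simp
  then have fix_eq: "S0 ** ?Si ** H = H"
    using Q W_invertible by (simp add: H' Q' matrix_mul_assoc)
  have "fa_cov H D ** matrix_inv D ** H = H + H ** transpose H ** matrix_inv D ** H"
    using D by (simp add: fa_cov_def matrix_algebra add.commute)
  then have "?Si ** (fa_cov H D ** matrix_inv D ** H) = ?Si ** (H + H ** transpose H ** matrix_inv D ** H)"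
    by simp
  then have "matrix_inv D ** H = ?Si ** H + ?Si ** H ** transpose H ** matrix_inv D ** H"
    using fa_cov_invertible by (simp add: matrix_algebra)
  then have "S0 ** (matrix_inv D ** H) = S0 ** ?Si ** H + (S0 ** ?Si ** H) ** transpose H ** matrix_inv D ** H"
    by (simp add: matrix_algebra)
  then show ?thesis unfolding fix_eq by (simp add: matrix_algebra)
qed

end

section \<open>Limit points\<close>

lemma tendsto_matrix_mult [tendsto_intros]:
  fixes f :: "'a \<Rightarrow> real^'b^'c" and g :: "'a \<Rightarrow> real^'d^'b"
  assumes "(f \<longlongrightarrow> A) F" "(g \<longlongrightarrow> B) F"
  shows "((\<lambda>x. f x ** g x) \<longlongrightarrow> A ** B) F"
  unfolding matrix_matrix_mult_def by (intro tendsto_intros assms)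

lemma tendsto_transpose [tendsto_intros]:
  fixes f :: "'a \<Rightarrow> real^'b^'c"
  assumes "(f \<longlongrightarrow> A) F"
  shows "((\<lambda>x. transpose (f x)) \<longlongrightarrow> transpose A) F"
  unfolding transpose_def by (intro tendsto_intros assms)

lemma tendsto_det [tendsto_intros]:
  fixes f :: "'a \<Rightarrow> real^'m^'m"
  assumes "(f \<longlongrightarrow> A) F"
  shows "((\<lambda>x. det (f x)) \<longlongrightarrow> det A) F"
  unfolding det_def by (intro tendsto_intros assms)

lemma tendsto_trace [tendsto_intros]:
  fixes f :: "'a \<Rightarrow> real^'m^'m"
  assumes "(f \<longlongrightarrow> A) F"
  shows "((\<lambda>x. trace (f x)) \<longlongrightarrow> trace A) F"
  unfolding trace_def by (intro tendsto_intros assms)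

lemma tendsto_diag_part [tendsto_intros]:
  fixes f :: "'a \<Rightarrow> real^'m^'m"
  assumes "(f \<longlongrightarrow> A) F"
  shows "((\<lambda>x. diag_part (f x)) \<longlongrightarrow> diag_part A) F"
proof -
  have "((\<lambda>x. if i = j then f x $ i $ i else 0) \<longlongrightarrow> (if i = j then A $ i $ i else 0)) F" for i j
    by (cases "i = j") (auto intro!: tendsto_intros assms)
  then show ?thesis unfolding diag_part_def by (intro tendsto_vec_lambda)
qed

lemma matrix_inv_cramer:
  fixes A :: "real^'m^'m"
  assumes "invertible A"
  shows "matrix_inv A = (\<chi> k j. det (\<chi> i l. if l = k then axis j 1 $ i else A $ i $ l) / det A)"
proof -
  have "A *v (matrix_inv A *v axis j 1) = axis j 1" for j
    using assms by (simp add: matrix_vector_mul_assoc)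
  then have "matrix_inv A *v axis j 1 = (\<chi> k. det (\<chi> i l. if l = k then axis j 1 $ i else A $ i $ l) / det A)" for j
    using cramer[of A] assms by (simp add: invertible_det_nz)
  then show ?thesis by (simp add: matrix_vector_mult_basis column_def vec_eq_iff)
qed

lemma tendsto_matrix_inv:
  fixes f :: "'a \<Rightarrow> real^'m^'m"
  assumes f: "(f \<longlongrightarrow> A) F" and inv: "\<And>x. invertible (f x)" "invertible A"
  shows "((\<lambda>x. matrix_inv (f x)) \<longlongrightarrow> matrix_inv A) F"
proof -
  have "((\<lambda>x. if l = k then axis j 1 $ i else f x $ i $ l) \<longlongrightarrow> (if l = k then axis j 1 $ i else A $ i $ l)) F"
    for i j k l :: 'm by (cases "l = k") (auto intro!: tendsto_intros f)
  then show ?thesis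
    unfolding matrix_inv_cramer[OF inv(1)] matrix_inv_cramer[OF inv(2)]
    using inv(2) by (intro tendsto_intros tendsto_vec_lambda f) (auto simp: invertible_det_nz)
qed

lemma tendsto_I_div:
  fixes f :: "'a \<Rightarrow> real^'m^'m"
  assumes f: "(f \<longlongrightarrow> B) F" and A: "pos_def A" and pd: "\<And>x. pos_def (f x)" "pos_def B"
  shows "((\<lambda>x. I_div A (f x)) \<longlongrightarrow> I_div A B) F"
  unfolding I_div_def using pos_def_det_pos[OF A] pos_def_det_pos[OF pd(2)]
  by (intro tendsto_intros tendsto_matrix_inv f pos_def_invertible pd) auto

lemma tendsto_fa_cov [tendsto_intros]:
  fixes f :: "'a \<Rightarrow> real^'k^'n"
  assumes "(f \<longlongrightarrow> H) F" "(g \<longlongrightarrow> D) F"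
  shows "((\<lambda>x. fa_cov (f x) (g x)) \<longlongrightarrow> fa_cov H D) F"
  unfolding fa_cov_def by (intro tendsto_intros assms)

lemma tendsto_next_cov:
  fixes f :: "'a \<Rightarrow> real^'k^'n" and g :: "'a \<Rightarrow> real^'n^'n"
  assumes "(f \<longlongrightarrow> H) F" "(g \<longlongrightarrow> D) F" and S0: "pos_def S0" and pd: "\<And>x. pos_def (g x)" "pos_def D"
  shows "((\<lambda>x. next_cov S0 (f x) (g x)) \<longlongrightarrow> next_cov S0 H D) F"
proof -
  have S: "((\<lambda>x. matrix_inv (fa_cov (f x) (g x))) \<longlongrightarrow> matrix_inv (fa_cov H D)) F"
    by (intro tendsto_matrix_inv tendsto_intros assms pos_def_invertible pos_def_fa_cov)
  have R: "((\<lambda>x. matrix_inv (R_update S0 (f x) (g x))) \<longlongrightarrow> matrix_inv (R_update S0 H D)) F"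
  proof (intro tendsto_matrix_inv pos_def_invertible pos_def_R_update S0 pd)
    show "((\<lambda>x. R_update S0 (f x) (g x)) \<longlongrightarrow> R_update S0 H D) F"
      unfolding R_update_def by (intro tendsto_intros assms S)
  qed
  show ?thesis unfolding next_cov_def next_HHT_def by (intro tendsto_intros assms S R)
qed

text \<open>
  The objective values decrease to a limit \<open>L\<close>. Along the subsequence, the objective before and after one
  iteration both tend to \<open>L\<close>; by continuity of \<open>next_cov\<close>, one iteration started at the limit point does not
  change the objective. The argument runs through \<open>fa_cov\<close> of the next iterate, a function of \<open>H\<close> and \<open>D\<close>
  alone, since the chosen square roots and the \<open>Q t\<close> may fail to converge.
\<close>

lemma limit_point_stationary:
  fixes S0 Dl :: "real^'n^'n" and Hl :: "real^'k^'n"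
  assumes S0: "pos_def S0" and D: "\<And>t. pos_def (D t)" and Dl: "pos_def Dl" "is_diagonal Dl"
    and step: "\<And>t. fa_cov (H (Suc t)) (D (Suc t)) = next_cov S0 (H t) (D t)"
    and dec: "\<And>t. I_div S0 (fa_cov (H (Suc t)) (D (Suc t))) \<le> I_div S0 (fa_cov (H t) (D t))"
    and r: "strict_mono r" and lim: "(\<lambda>n. H (r n)) \<longlonglongrightarrow> Hl" "(\<lambda>n. D (r n)) \<longlonglongrightarrow> Dl"
  shows "Hl = (S0 - Hl ** transpose Hl) ** matrix_inv Dl ** Hl"
proof -
  define f where "f t = I_div S0 (fa_cov (H t) (D t))" for t
  have "decseq f" unfolding decseq_Suc_iff f_def using dec by blast
  moreover have "f t \<ge> 0" for t unfolding f_def by (intro I_div_nonneg S0 pos_def_fa_cov D)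
  ultimately obtain L where L: "f \<longlonglongrightarrow> L" using decseq_convergent[of f 0] by blast
  obtain W :: "real^'k^'k" where W: "transpose W ** W = R_update S0 Hl Dl"
    using pos_def_square_root_exists[OF pos_def_R_update[OF S0 Dl(1)]] by blast
  define H' where "H' = S0 ** matrix_inv (fa_cov Hl Dl) ** Hl ** matrix_inv W"
  define D' where "D' = diag_part (S0 - H' ** transpose H')"
  \<comment> \<open>The factor \<open>Q\<close> is free at the limit point; the identity is the simplest invertible choice.\<close>
  interpret limit: fa_step S0 Dl D' Hl H' "mat 1" W W
    by unfold_locales (simp_all add: S0 Dl W H'_def D'_def pos_def_mat_1)
  have "(\<lambda>n. f (r n)) \<longlonglongrightarrow> I_div S0 (fa_cov Hl Dl)"
    unfolding f_def by (intro tendsto_I_div tendsto_fa_cov lim S0 pos_def_fa_cov D Dl)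
  moreover have "(\<lambda>n. f (r n)) \<longlonglongrightarrow> L"
    using LIMSEQ_subseq_LIMSEQ[OF L r] by (simp add: o_def)
  ultimately have 1: "L = I_div S0 (fa_cov Hl Dl)" by (rule LIMSEQ_unique[rotated])
  have "(\<lambda>n. f (Suc (r n))) \<longlonglongrightarrow> I_div S0 (next_cov S0 Hl Dl)"
    unfolding f_def step
  proof (intro tendsto_I_div tendsto_next_cov lim S0 D Dl)
    show "pos_def (next_cov S0 (H (r n)) (D (r n)))" for n
      unfolding step[symmetric] by (intro pos_def_fa_cov D)
    show "pos_def (next_cov S0 Hl Dl)"
      unfolding limit.fa_cov_step[symmetric] by (intro pos_def_fa_cov limit.D'_pos_def)
  qed
  moreover have "(\<lambda>n. f (Suc (r n))) \<longlonglongrightarrow> L"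
    using LIMSEQ_subseq_LIMSEQ[OF LIMSEQ_Suc[OF L] r] by (simp add: o_def)
  ultimately have 2: "L = I_div S0 (next_cov S0 Hl Dl)" by (rule LIMSEQ_unique[rotated])
  show ?thesis by (rule limit.stationary_equation) (simp add: limit.fa_cov_step flip: 1 2)
qed

text \<open>
  The diagonal entries of a limit are nonnegative, and invertibility excludes zero.
\<close>

lemma limit_pos_def_diagonal:
  fixes D :: "nat \<Rightarrow> real^'n^'n"
  assumes D: "\<And>t. pos_def (D t)" "\<And>t. is_diagonal (D t)" and lim: "(\<lambda>n. D (r n)) \<longlonglongrightarrow> Dl"
    and inv: "invertible Dl"
  shows "pos_def Dl" "is_diagonal Dl"
proof -
  have comp: "(\<lambda>n. D (r n) $ i $ j) \<longlonglongrightarrow> Dl $ i $ j" for i j by (intro tendsto_intros lim)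
  have "Dl $ i $ j = 0" if "i \<noteq> j" for i j
  proof -
    have "(\<lambda>n. D (r n) $ i $ j) = (\<lambda>n. 0)" using D(2) that by (auto simp: is_diagonal_def)
    with comp[of i j] show ?thesis by (simp add: LIMSEQ_const_iff)
  qed
  then show diag: "is_diagonal Dl" by (simp add: is_diagonal_def)
  have "det Dl = (\<Prod>i\<in>UNIV. Dl $ i $ i)" using diag by (intro det_diagonal) (auto simp: is_diagonal_def)
  then have "Dl $ i $ i \<noteq> 0" for i using inv by (auto simp: invertible_det_nz)
  moreover have "Dl $ i $ i \<ge> 0" for i
    using comp[of i i] by (rule LIMSEQ_le_const) (use pos_def_diagonal_pos[OF D(1)] less_imp_le in blast)
  ultimately show "pos_def Dl" unfolding pos_def_diagonal_iff[OF diag] by (simp add: less_le)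
qed

section \<open>Properties of the algorithm\<close>

theorem proposition4p3:
  fixes S0 :: "real^'n^'n"
    and H :: "nat \<Rightarrow> real^'k^'n"
    and D :: "nat \<Rightarrow> real^'n^'n"
    and Q R W :: "nat \<Rightarrow> real^'k^'k"
  assumes "CARD('k) < CARD('n)"
    and "pos_def S0"
    and "fa_algorithm S0 H D Q R W"
  shows "
     \<comment> \<open>(a)\<close>
     ((\<forall>t. pos_def (D t)) \<and> (\<forall>t\<ge>1. \<forall>i. D t $ i $ i \<le> S0 $ i $ i)) \<and>
     \<comment> \<open>(b)\<close>
     (\<forall>t. invertible (R t)) \<and>
     \<comment> \<open>(c)\<close>
     (rank (H 0) = CARD('k) \<longrightarrow> (\<forall>t. rank (H t) = CARD('k))) \<and>
     \<comment> \<open>(d)\<close>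
     (\<forall>t\<ge>1. psd_le (H t ** transpose (H t)) S0) \<and>
     \<comment> \<open>(e): stationary up to the choice of the square root of the identity\<close>
     (S0 = H 0 ** transpose (H 0) + D 0 \<longrightarrow>
       (\<forall>t. R t = mat 1 \<and> D t = D 0 \<and>
            (\<exists>U. orthogonal_matrix U \<and> H t = H 0 ** U) \<and>
            (W t = mat 1 \<longrightarrow> H (Suc t) = H t))) \<and>
     \<comment> \<open>(f)\<close>
     (\<forall>t. I_div S0 (fa_cov (H (Suc t)) (D (Suc t))) \<le> I_div S0 (fa_cov (H t) (D t))) \<and>
     (\<forall>t. \<exists>!M. is_first_partial_min S0 (Sigma_HDQ (H t) (D t) (Q t)) M) \<and>
     (\<forall>t M M'.
       is_first_partial_min S0 (Sigma_HDQ (H t) (D t) (Q t)) M \<longrightarrow>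
       is_first_partial_min S0 (Sigma_HDQ (H (Suc t)) (D (Suc t)) (Q (Suc t))) M' \<longrightarrow>
       I_div S0 (fa_cov (H (Suc t)) (D (Suc t))) - I_div S0 (fa_cov (H t) (D t)) =
         - (I_div (Sigma_HDQ (H (Suc t)) (D (Suc t)) (Q (Suc t))) (Sigma_HDQ (H t) (D t) (Q t))
            + I_div M M')) \<and>
     \<comment> \<open>(g)\<close>
     (\<forall>Hl Dl. is_limit_point (\<lambda>t. (H t, D t)) (Hl, Dl) \<longrightarrow>
       (invertible Dl \<longrightarrow> Hl = (S0 - Hl ** transpose Hl) ** matrix_inv Dl ** Hl) \<and>
       Dl = diag_part (S0 - Hl ** transpose Hl))"
proof -
  have S0: "pos_def S0" by fact
  note alg = assms(3)[unfolded fa_algorithm_def]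
  have R: "R t = R_update S0 (H t) (D t)" for t using alg by blast
  \<comment> \<open>A run constrains \<open>W t\<close> only if \<open>R t\<close> is positive definite, which depends on \<open>D t\<close> being so; hence
    the induction that carries positivity from one step to the next precedes everything else.\<close>
  have step: "fa_step S0 (D t) (D (Suc t)) (H t) (H (Suc t)) (Q t) (Q (Suc t)) (W t)"
    if "pos_def (D t)" "is_diagonal (D t)" "invertible (Q t)" for t
  proof unfold_locales
    have "pos_def (R t)" unfolding R by (intro pos_def_R_update S0 that)
    then show "transpose (W t) ** W t = R_update S0 (H t) (D t)"
      using alg R by (simp add: is_matrix_sqrt_def)
  qed (use S0 that alg in blast)+
  have inv: "pos_def (D t) \<and> is_diagonal (D t) \<and> invertible (Q t)" for t
  proof (induction t)
    case 0
    then show ?case using alg by blast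
  next
    case (Suc t)
    then interpret fa_step S0 "D t" "D (Suc t)" "H t" "H (Suc t)" "Q t" "Q (Suc t)" "W t"
      by (intro step) auto
    show ?case using D'_pos_def D'_diagonal Q'_invertible by blast
  qed
  interpret run: fa_step S0 "D t" "D (Suc t)" "H t" "H (Suc t)" "Q t" "Q (Suc t)" "W t" for t
    by (intro step) (use inv in auto)
  have first_min: "is_first_partial_min S0 (Sigma_HDQ (H t) (D t) (Q t)) M \<longleftrightarrow>
      M = regression_block S0 (regression_coeff (H t) (D t) (Q t)) (residual_cov (H t) (D t) (Q t))" for t M
    using first_partial_min_iff[OF S0] inv by blast
  have a: "(\<forall>t. pos_def (D t)) \<and> (\<forall>t\<ge>1. \<forall>i. D t $ i $ i \<le> S0 $ i $ i)"
  proof (intro conjI allI impI)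
    fix t :: nat and i assume "t \<ge> 1"
    then show "D t $ i $ i \<le> S0 $ i $ i" using run.D'_le[of "t - 1"] by simp
  qed (use inv in blast)
  have b: "invertible (R t)" for t unfolding R by (intro pos_def_invertible pos_def_R_update S0 run.D)
  have c: "rank (H t) = rank (H 0)" for t by (induction t) (simp_all add: run.rank_step)
  have d: "psd_le (H t ** transpose (H t)) S0" if "t \<ge> 1" for t
    using run.HHT_psd_le[of "t - 1"] that by simp
  have e: "R t = mat 1 \<and> D t = D 0 \<and> (\<exists>U. orthogonal_matrix U \<and> H t = H 0 ** U) \<and>
      (W t = mat 1 \<longrightarrow> H (Suc t) = H t)" if S0_eq: "S0 = H 0 ** transpose (H 0) + D 0" for t
  proof -
    \<comment> \<open>Once the model covariance is \<open>S0\<close>, the square root of \<open>R t = mat 1\<close> is orthogonal, so \<open>H\<close> is only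
      rotated, and \<open>H ** transpose H\<close> and \<open>D\<close> stay fixed.\<close>
    have one: "R t = mat 1 \<and> orthogonal_matrix (matrix_inv (W t)) \<and> H (Suc t) = H t ** matrix_inv (W t)
        \<and> D (Suc t) = D t"
      if cov: "fa_cov (H t) (D t) = S0" for t
    proof -
      have Rt: "R t = mat 1" by (simp add: R R_update_def cov)
      have "transpose (W t) ** W t = mat 1" using run.W[of t] Rt R by simp
      then have inv_W: "matrix_inv (W t) = transpose (W t)" and WW: "orthogonal_matrix (W t)"
        by (auto intro!: matrix_inv_eqI simp: orthogonal_matrix matrix_left_right_inverse)
      have U: "orthogonal_matrix (matrix_inv (W t))"
        using WW by (simp add: inv_W orthogonal_matrix_transpose)
      have HS: "H (Suc t) = H t ** matrix_inv (W t)"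
        using S0 by (simp add: run.H' cov)
      have "H (Suc t) ** transpose (H (Suc t)) = H t ** (matrix_inv (W t) ** transpose (matrix_inv (W t))) ** transpose (H t)"
        by (simp add: HS matrix_algebra)
      also have "\<dots> = H t ** transpose (H t)" using U by (simp add: orthogonal_matrix_def)
      finally have "S0 - H (Suc t) ** transpose (H (Suc t)) = D t" by (simp add: fa_cov_def flip: cov)
      then have "D (Suc t) = diag_part (D t)" by (simp add: run.D')
      also have "\<dots> = D t" using run.D(2)[of t] by (auto simp: diag_part_def is_diagonal_def vec_eq_iff)
      finally show ?thesis using Rt U HS by blast
    qed
    have "fa_cov (H t) (D t) = S0 \<and> D t = D 0 \<and> (\<exists>U. orthogonal_matrix U \<and> H t = H 0 ** U)" for t
    proof (induction t)
      case 0
      then show ?case using S0_eq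
        by (auto simp: fa_cov_def orthogonal_matrix_id intro!: exI[of _ "mat 1"])
    next
      case (Suc t)
      then obtain U where U: "orthogonal_matrix U" "H t = H 0 ** U" by blast
      note one = one[OF conjunct1[OF Suc]]
      have "H (Suc t) = H 0 ** (U ** matrix_inv (W t))"
        using one U by (simp add: matrix_mul_assoc)
      moreover have orth: "orthogonal_matrix (U ** matrix_inv (W t))"
        using one U by (intro orthogonal_matrix_mul) auto
      moreover have "H 0 ** (U ** matrix_inv (W t)) ** transpose (H 0 ** (U ** matrix_inv (W t)))
          = H 0 ** ((U ** matrix_inv (W t)) ** transpose (U ** matrix_inv (W t))) ** transpose (H 0)"
        by (simp add: matrix_algebra)
      ultimately show ?case using one Suc S0_eq
        by (auto simp: fa_cov_def orthogonal_matrix_def)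
    qed
    then show ?thesis using one[of t] by (auto simp: matrix_mul_rid)
  qed
  have f3: "I_div S0 (fa_cov (H (Suc t)) (D (Suc t))) - I_div S0 (fa_cov (H t) (D t)) =
         - (I_div (Sigma_HDQ (H (Suc t)) (D (Suc t)) (Q (Suc t))) (Sigma_HDQ (H t) (D t) (Q t))
            + I_div M M')"
    if "is_first_partial_min S0 (Sigma_HDQ (H t) (D t) (Q t)) M"
      "is_first_partial_min S0 (Sigma_HDQ (H (Suc t)) (D (Suc t)) (Q (Suc t))) M'" for t M M'
    using run.I_div_step[of t] that unfolding first_min run.first_min_hidden by simp
  have g: "(invertible Dl \<longrightarrow> Hl = (S0 - Hl ** transpose Hl) ** matrix_inv Dl ** Hl) \<and>
       Dl = diag_part (S0 - Hl ** transpose Hl)"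
    if lp: "is_limit_point (\<lambda>t. (H t, D t)) (Hl, Dl)" for Hl Dl
  proof -
    obtain r where r: "strict_mono r" "(\<lambda>n. (H (r n), D (r n))) \<longlonglongrightarrow> (Hl, Dl)"
      using lp by (auto simp: is_limit_point_def o_def)
    have lim: "(\<lambda>n. H (r n)) \<longlonglongrightarrow> Hl" "(\<lambda>n. D (r n)) \<longlonglongrightarrow> Dl"
      using tendsto_fst[OF r(2)] tendsto_snd[OF r(2)] by simp_all
    \<comment> \<open>The update formula for \<open>D\<close> holds from iteration 1 on, and \<open>r (Suc n)\<close> is at least 1.\<close>
    have "D (r (Suc n)) = diag_part (S0 - H (r (Suc n)) ** transpose (H (r (Suc n))))" for n
      using run.D'[of "r (Suc n) - 1"] strict_mono_imp_increasing[OF r(1), of "Suc n"] by simp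
    moreover have "(\<lambda>n. D (r (Suc n))) \<longlonglongrightarrow> Dl" using lim(2) by (rule LIMSEQ_Suc)
    moreover have "(\<lambda>n. diag_part (S0 - H (r (Suc n)) ** transpose (H (r (Suc n)))))
        \<longlonglongrightarrow> diag_part (S0 - Hl ** transpose Hl)"
      by (intro tendsto_intros LIMSEQ_Suc[OF lim(1)])
    ultimately have "Dl = diag_part (S0 - Hl ** transpose Hl)" using LIMSEQ_unique by simp
    moreover have "Hl = (S0 - Hl ** transpose Hl) ** matrix_inv Dl ** Hl" if "invertible Dl"
    proof (rule limit_point_stationary[OF S0 _ _ _ _ _ r(1) lim])
      show "pos_def Dl" "is_diagonal Dl"
        by (rule limit_pos_def_diagonal[where D = D and r = r]; use inv lim that in blast)+
    qed (use inv run.fa_cov_step run.I_div_decreases in blast)+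
    ultimately show ?thesis by blast
  qed
  have f2: "\<exists>!M. is_first_partial_min S0 (Sigma_HDQ (H t) (D t) (Q t)) M" for t
    unfolding first_min by simp
  show ?thesis
    apply (intro conjI)
    subgoal using a by (rule conjunct1)
    subgoal using a by (rule conjunct2)
    subgoal using b by (rule allI)
    subgoal by (intro impI allI) (rule trans[OF c])
    subgoal using d by (intro allI impI)
    subgoal using e by (intro impI allI)
    subgoal using run.I_div_decreases by (rule allI)
    subgoal using f2 by (rule allI)
    subgoal using f3 by (intro impI allI)
    subgoal using g by (intro impI allI)
    done
qed

end
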